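(* For every finitely generated free group $F_n$, the function $\mathrm{dc}_{F_n}(\cdot)$ is computable. More precisely, there is an algorithm which, on input $h_1,\ldots,h_r\in F_n$, computes the value of $\mathrm{dc}_{F_n}(\langle h_1,\ldots,h_r\rangle)$ and outputs a free basis of a finitely generated subgroup $K$ of $F_n$ at which the supremum defining $\mathrm{dc}_{F_n}(\langle h_1,\ldots,h_r\rangle)$ is attained.
   Context: $F_n$ is the free group on a fixed alphabet $X=\{x_1,\ldots,x_n\}$; its elements are given as (reduced) words on $X^{\pm1}$. For a group $G$, $\mathrm{r}(G)$ denotes the rank of $G$ (minimum cardinality of a generating set), and the reduced rank is $\tilde{\mathrm r}(G)=\max\{0,\mathrm r(G)-1\}$. For a finitely generated subgroup $H$ of a group $G$, the degree of compression of $H$ in $G$ is $\mathrm{dc}_G(H)=\sup_K\{\tilde{\mathrm r}(H)/\tilde{\mathrm r}(K)\}$, where $K$ runs over all finitely generated subgroups $K$ of $G$ with $H\leqslant K$, and $0/0$ is understood to be $1$. *)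

theory Defs
  imports
    "HOL-Algebra.Generated_Groups"
    "HOL-Library.Extended_Real"
    "HOL-Library.Nat_Bijection"
begin

section \<open>Free groups as groups of reduced words\<close>

text \<open>The letter \<open>(x, True)\<close> stands for \<open>x\<close>, and \<open>(x, False)\<close> for its formal inverse.\<close>

type_synonym 'a letter = "'a \<times> bool"
type_synonym 'a word = "'a letter list"

definition inv_letter :: "'a letter \<Rightarrow> 'a letter" where
  "inv_letter a = (fst a, \<not> snd a)"

definition reduced :: "'a word \<Rightarrow> bool" where
  "reduced w \<longleftrightarrow> successively (\<lambda>a b. b \<noteq> inv_letter a) w"

fun cons_cancel :: "'a letter \<Rightarrow> 'a word \<Rightarrow> 'a word" where
  "cons_cancel a [] = [a]"
| "cons_cancel a (b # w) = (if b = inv_letter a then w else a # b # w)"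

definition reduce :: "'a word \<Rightarrow> 'a word" where
  "reduce w = foldr cons_cancel w []"

definition free_group :: "'a set \<Rightarrow> 'a word monoid" where
  "free_group X =
     \<lparr>carrier = {w. reduced w \<and> fst ` set w \<subseteq> X}, mult = \<lambda>u v. reduce (u @ v), one = []\<rparr>"

abbreviation F :: "nat \<Rightarrow> nat word monoid" where
  "F n \<equiv> free_group {1..n}"

definition word_value :: "('g, 'b) monoid_scheme \<Rightarrow> 'g word \<Rightarrow> 'g" where
  "word_value G w =
     foldr (\<lambda>(b, pos) g. (if pos then b else inv\<^bsub>G\<^esub> b) \<otimes>\<^bsub>G\<^esub> g) w \<one>\<^bsub>G\<^esub>"

definition free_basis :: "('g, 'b) monoid_scheme \<Rightarrow> 'g set \<Rightarrow> bool" where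
  "free_basis G B \<longleftrightarrow> B \<subseteq> carrier G \<and> word_value G \<in> iso (free_group B) G"


section \<open>Rank and degree of compression\<close>

definition finitely_generated :: "('g, 'b) monoid_scheme \<Rightarrow> bool" where
  "finitely_generated G \<longleftrightarrow>
     (\<exists>S. finite S \<and> S \<subseteq> carrier G \<and> generate G S = carrier G)"

text \<open>Only meaningful for finitely generated groups, which are the only ones it is applied to.\<close>

definition group_rank :: "('g, 'b) monoid_scheme \<Rightarrow> nat" where
  "group_rank G =
     (LEAST k. \<exists>S. finite S \<and> S \<subseteq> carrier G \<and> generate G S = carrier G \<and> card S = k)"

text \<open>Truncated subtraction on \<^typ>\<open>nat\<close> provides the maximum with \<open>0\<close>.\<close>

definition reduced_rank :: "('g, 'b) monoid_scheme \<Rightarrow> nat" where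
  "reduced_rank G = group_rank G - 1"

definition fg_overgroups :: "('g, 'b) monoid_scheme \<Rightarrow> 'g set \<Rightarrow> 'g set set" where
  "fg_overgroups G H =
     {K. subgroup K G \<and> finitely_generated (G\<lparr>carrier := K\<rparr>) \<and> H \<subseteq> K}"

text \<open>
  Quotients and suprema are taken in the extended reals: a positive number divided by \<open>0\<close>
  is \<open>\<infinity>\<close>, so neither the division nor the supremum in \<open>dc\<close> involves a default value.
\<close>

definition compression_ratio :: "('g, 'b) monoid_scheme \<Rightarrow> 'g set \<Rightarrow> 'g set \<Rightarrow> ereal" where
  "compression_ratio G H K =
     (let h = reduced_rank (G\<lparr>carrier := H\<rparr>); k = reduced_rank (G\<lparr>carrier := K\<rparr>)
      in if h = 0 \<and> k = 0 then 1 else ereal (real h) / ereal (real k))"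

definition dc :: "('g, 'b) monoid_scheme \<Rightarrow> 'g set \<Rightarrow> ereal" where
  "dc G H = (SUP K \<in> fg_overgroups G H. compression_ratio G H K)"


section \<open>Partial recursive functions\<close>

datatype recf =
    Zero
  | Succ
  | Proj nat
  | Comp recf "recf list"
  | PrimRec recf recf
  | Mu recf

text \<open>
  \<open>evals e xs y\<close>: the program \<open>e\<close> halts on the arguments \<open>xs\<close> with result \<open>y\<close>.
  \<open>PrimRec f g\<close> recurses on the first argument; \<open>g\<close> receives the
  predecessor, the previous value and the parameters, in this order.
  \<open>Mu f\<close> searches for the least zero of \<open>f\<close> in its first argument,
  and requires \<open>f\<close> to halt on all smaller values.
\<close>

inductive evals :: "recf \<Rightarrow> nat list \<Rightarrow> nat \<Rightarrow> bool" where
  evals_Zero: "evals Zero xs 0"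
| evals_Succ: "evals Succ [x] (Suc x)"
| evals_Proj: "i < length xs \<Longrightarrow> evals (Proj i) xs (xs ! i)"
| evals_Comp: "\<lbrakk>length ys = length gs; \<forall>i<length gs. evals (gs ! i) xs (ys ! i); evals f ys z\<rbrakk>
    \<Longrightarrow> evals (Comp f gs) xs z"
| evals_PrimRec_0: "evals f xs y \<Longrightarrow> evals (PrimRec f g) (0 # xs) y"
| evals_PrimRec_Suc: "\<lbrakk>evals (PrimRec f g) (k # xs) y; evals g (k # y # xs) z\<rbrakk>
    \<Longrightarrow> evals (PrimRec f g) (Suc k # xs) z"
| evals_Mu: "\<lbrakk>evals f (k # xs) 0; \<forall>j<k. \<exists>y. evals f (j # xs) (Suc y)\<rbrakk>
    \<Longrightarrow> evals (Mu f) xs k"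

inductive_cases evals_ZeroE: "evals Zero xs z"
inductive_cases evals_SuccE: "evals Succ xs z"
inductive_cases evals_ProjE: "evals (Proj i) xs z"
inductive_cases evals_CompE: "evals (Comp f gs) xs z"
inductive_cases evals_PrimRec_0E: "evals (PrimRec f g) (0 # xs) z"
inductive_cases evals_PrimRec_SucE: "evals (PrimRec f g) (Suc k # xs) z"
inductive_cases evals_MuE: "evals (Mu f) xs z"

lemma evals_deterministic: "evals e xs y \<Longrightarrow> evals e xs z \<Longrightarrow> y = z"
proof (induction arbitrary: z rule: evals.induct)
  case (evals_Zero xs)
  then show ?case by (blast elim: evals_ZeroE)
next
  case (evals_Succ x)
  then show ?case by (blast elim: evals_SuccE)
next
  case (evals_Proj i xs)
  from evals_Proj.prems show ?case by (blast elim: evals_ProjE)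
next
  case (evals_Comp ys gs xs f y)
  from evals_Comp.prems obtain ys' where ys': "length ys' = length gs"
    "\<forall>i<length gs. evals (gs ! i) xs (ys' ! i)" "evals f ys' z"
    by (rule evals_CompE)
  have "ys = ys'"
    using evals_Comp.IH(1) evals_Comp.hyps(1) ys'(1,2) by (intro nth_equalityI) simp_all
  with ys'(3) show ?case
    using evals_Comp.IH(2) by blast
next
  case (evals_PrimRec_0 f xs y g)
  from evals_PrimRec_0.prems have "evals f xs z" by (rule evals_PrimRec_0E)
  then show ?case by (rule evals_PrimRec_0.IH)
next
  case (evals_PrimRec_Suc f g k xs y y')
  from evals_PrimRec_Suc.prems obtain u where u: "evals (PrimRec f g) (k # xs) u"
    "evals g (k # u # xs) z"
    by (rule evals_PrimRec_SucE)
  have "y = u" using u(1) by (rule evals_PrimRec_Suc.IH(1))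
  with u(2) show ?case using evals_PrimRec_Suc.IH(2) by blast
next
  case (evals_Mu f k xs)
  from evals_Mu.prems have z: "evals f (z # xs) 0" "\<forall>j<z. \<exists>y. evals f (j # xs) (Suc y)"
    by (blast elim: evals_MuE)+
  show ?case
  proof (rule linorder_cases[of k z])
    assume "k < z"
    with z(2) obtain y where "evals f (k # xs) (Suc y)" by blast
    then have "0 = Suc y" by (rule evals_Mu.IH(1))
    then show ?thesis by simp
  next
    assume "z < k"
    with evals_Mu.IH(2) obtain y where "\<forall>u. evals f (z # xs) u \<longrightarrow> Suc y = u" by blast
    with z(1) have "Suc y = 0" by blast
    then show ?thesis by simp
  qed
qed

definition computable_on ::
    "('a \<Rightarrow> nat) \<Rightarrow> ('b \<Rightarrow> nat) \<Rightarrow> 'a set \<Rightarrow> ('a \<Rightarrow> 'b) \<Rightarrow> bool" where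
  "computable_on code_in code_out D f \<longleftrightarrow>
     (\<exists>e. \<forall>x\<in>D. evals e [code_in x] (code_out (f x)))"

definition letter_code :: "nat letter \<Rightarrow> nat" where
  "letter_code a = prod_encode (fst a, of_bool (snd a))"

definition word_code :: "nat word \<Rightarrow> nat" where
  "word_code w = list_encode (map letter_code w)"

definition tuple_code :: "nat word list \<Rightarrow> nat" where
  "tuple_code ws = list_encode (map word_code ws)"

text \<open>Numerator and denominator in lowest terms, the denominator being positive.\<close>

definition rat_code :: "rat \<Rightarrow> nat" where
  "rat_code q = prod_encode (map_prod int_encode int_encode (quotient_of q))"

definition output_code :: "rat \<times> nat word list \<Rightarrow> nat" where
  "output_code = prod_encode \<circ> map_prod rat_code tuple_code"

end

theory Submission
  imports Defs
begin

text \<open>The reduced rank of \<open>H\<close> is the numerator of every ratio, so the supremum is attained at any finitely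
generated overgroup \<open>K\<close> of least rank (\<open>dc_eq_ratio_of_minimal_rank\<close>). An algorithm therefore has to
find such a \<open>K\<close> and to determine the rank of \<open>H\<close>. Both rest on Nielsen reduced sets.

Let \<open>B\<close> be Nielsen reduced. In a product of elements of \<open>B\<close> and their inverses, in which no factor is
followed by its own inverse, a letter of each factor survives and at most half of a factor cancels
against each neighbour. Hence the product is at least as long as the number of its factors, and at
least as long as each of its factors (\<open>nielsen_product\<close>). This has three consequences. The set \<open>B\<close> is a
free basis of the subgroup that it generates (\<open>nielsen_free_basis\<close>). Membership in this subgroup is
decidable, because only products of a bounded number of factors have to be inspected
(\<open>nielsen_in_products\<close>). Finally, if every element of \<open>B\<close> is needed to express the given generators of
\<open>H\<close>, then every element of \<open>B\<close> is at most as long as one of these generators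
(\<open>nielsen_irredundant_length\<close>).

Every finitely generated subgroup of a free group of finite rank has a Nielsen reduced generating set
with as many elements as its rank (\<open>nielsen_generators_exist\<close>). For an overgroup of least rank no
element of such a set can be removed, since the others would generate an overgroup of smaller rank.
So the set is found among the finitely many sets of words of bounded length: the shortest of the
Nielsen reduced sets in this range that generate an overgroup of \<open>H\<close> (\<open>optimal_basis\<close>). A basis of \<open>H\<close>
itself lies in the same range; it is recognized by expressing its elements as products of the
generators of \<open>H\<close>, which are enumerated until they suffice (\<open>search_succeeds\<close>). Its size is the rank of \<open>H\<close>,
because a group with a finite free basis cannot be generated by fewer elements
(\<open>free_basis_card_le\<close>).

For computability, functions between types with a numerical coding are considered that are
represented by total recursive functions on codes. They are closed under recursion on numbers and
lists and under bounded search, and so contain every step of the algorithm except the enumeration of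
products of generators, which takes one application of minimization (\<open>computable_on_Least\<close>).\<close>

section \<open>Total recursive functions\<close>

definition recursive :: "nat \<Rightarrow> (nat list \<Rightarrow> nat) \<Rightarrow> bool" where
  "recursive k f \<longleftrightarrow> (\<exists>e. \<forall>xs. length xs = k \<longrightarrow> evals e xs (f xs))"

lemma recursive_cong:
  "recursive k f \<Longrightarrow> (\<And>xs. length xs = k \<Longrightarrow> f xs = g xs) \<Longrightarrow> recursive k g"
  unfolding recursive_def by metis

lemma recursive_proj: "i < k \<Longrightarrow> recursive k (\<lambda>xs. xs ! i)"
  unfolding recursive_def by (rule exI[of _ "Proj i"]) (auto intro: evals_Proj)

lemma recursive_zero: "recursive k (\<lambda>xs. 0)"
  unfolding recursive_def by (rule exI[of _ Zero]) (auto intro: evals_Zero)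

lemma recursive_compose:
  assumes f: "recursive (length gs) f" and gs: "\<forall>g\<in>set gs. recursive k g"
  shows "recursive k (\<lambda>xs. f (map (\<lambda>g. g xs) gs))"
proof -
  obtain ef where ef: "\<And>ys. length ys = length gs \<Longrightarrow> evals ef ys (f ys)"
    using f unfolding recursive_def by blast
  have "\<exists>E. \<forall>g\<in>set gs. \<forall>xs. length xs = k \<longrightarrow> evals (E g) xs (g xs)"
    using gs unfolding recursive_def by (intro bchoice) blast
  then obtain E where E: "\<And>g xs. g \<in> set gs \<Longrightarrow> length xs = k \<Longrightarrow> evals (E g) xs (g xs)"
    by blast
  have "evals (Comp ef (map E gs)) xs (f (map (\<lambda>g. g xs) gs))" if "length xs = k" for xs
    using that by (intro evals_Comp[where ys = "map (\<lambda>g. g xs) gs"]) (auto intro: E ef)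
  then show ?thesis unfolding recursive_def by blast
qed

lemma recursive_compose1:
  "recursive 1 (\<lambda>xs. f (xs ! 0)) \<Longrightarrow> recursive k g \<Longrightarrow> recursive k (\<lambda>xs. f (g xs))"
  using recursive_compose[of "[g]" "\<lambda>xs. f (xs ! 0)" k] by simp

lemma recursive_compose2:
  "recursive 2 (\<lambda>xs. f (xs ! 0) (xs ! 1)) \<Longrightarrow> recursive k g \<Longrightarrow> recursive k h \<Longrightarrow>
    recursive k (\<lambda>xs. f (g xs) (h xs))"
  using recursive_compose[of "[g, h]" "\<lambda>xs. f (xs ! 0) (xs ! 1)" k] by (simp add: numeral_2_eq_2)

lemma recursive_Suc: "recursive k f \<Longrightarrow> recursive k (\<lambda>xs. Suc (f xs))"
proof -
  have "evals Succ xs (Suc (xs ! 0))" if "length xs = 1" for xs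
    using that by (cases xs) (auto intro: evals_Succ)
  then have "recursive 1 (\<lambda>xs. Suc (xs ! 0))" unfolding recursive_def by blast
  then show "recursive k f \<Longrightarrow> recursive k (\<lambda>xs. Suc (f xs))" by (rule recursive_compose1)
qed

lemma recursive_primrec:
  assumes f: "recursive k f" and g: "recursive (Suc (Suc k)) g"
  shows "recursive (Suc k) (\<lambda>xs. rec_nat (f (tl xs)) (\<lambda>n y. g (n # y # tl xs)) (hd xs))"
proof -
  obtain ef where ef: "\<And>ys. length ys = k \<Longrightarrow> evals ef ys (f ys)"
    using f unfolding recursive_def by blast
  obtain eg where eg: "\<And>ys. length ys = Suc (Suc k) \<Longrightarrow> evals eg ys (g ys)"
    using g unfolding recursive_def by blast
  have "evals (PrimRec ef eg) (n # ys) (rec_nat (f ys) (\<lambda>n y. g (n # y # ys)) n)"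
    if "length ys = k" for n ys
    by (induction n) (auto intro!: evals_PrimRec_0 evals_PrimRec_Suc ef eg simp: that)
  then have "evals (PrimRec ef eg) xs (rec_nat (f (tl xs)) (\<lambda>n y. g (n # y # tl xs)) (hd xs))"
    if "length xs = Suc k" for xs
    using that by (cases xs) auto
  then show ?thesis unfolding recursive_def by blast
qed

lemma recursive_Least:
  assumes p: "recursive (Suc k) p" and ex: "\<And>xs. length xs = k \<Longrightarrow> \<exists>n. p (n # xs) = 0"
  shows "recursive k (\<lambda>xs. LEAST n. p (n # xs) = 0)"
proof -
  obtain e where e: "\<And>ys. length ys = Suc k \<Longrightarrow> evals e ys (p ys)"
    using p unfolding recursive_def by blast
  have "evals (Mu e) xs (LEAST n. p (n # xs) = 0)" if "length xs = k" for xs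
  proof (rule evals_Mu)
    show "evals e ((LEAST n. p (n # xs) = 0) # xs) 0"
      using e[of "(LEAST n. p (n # xs) = 0) # xs"] LeastI_ex[OF ex[OF that]] that by simp
    show "\<forall>j<LEAST n. p (n # xs) = 0. \<exists>y. evals e (j # xs) (Suc y)"
    proof (intro allI impI)
      fix j assume "j < (LEAST n. p (n # xs) = 0)"
      then have "p (j # xs) \<noteq> 0" by (auto dest: not_less_Least)
      then obtain y where "p (j # xs) = Suc y" using not0_implies_Suc by blast
      then show "\<exists>y. evals e (j # xs) (Suc y)" using e[of "j # xs"] that by auto
    qed
  qed
  then show ?thesis unfolding recursive_def by blast
qed

lemma nth_tl_hd: "length xs = Suc k \<Longrightarrow> tl xs ! i = xs ! Suc i" "length xs = Suc k \<Longrightarrow> hd xs = xs ! 0"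
  by (cases xs; simp)+

lemma recursive_add: "recursive 2 (\<lambda>xs. xs ! 0 + xs ! 1)"
proof -
  have "recursive 2 (\<lambda>xs. rec_nat (tl xs ! 0) (\<lambda>n y. Suc ((n # y # tl xs) ! 1)) (hd xs))"
    unfolding numeral_2_eq_2 by (intro recursive_primrec recursive_Suc recursive_proj) simp_all
  moreover have "rec_nat (m::nat) (\<lambda>n y. Suc y) l = l + m" for m l by (induction l) auto
  ultimately show ?thesis
    by (elim recursive_cong) (simp add: nth_tl_hd numeral_2_eq_2)
qed

lemma recursive_pred: "recursive 1 (\<lambda>xs. xs ! 0 - 1)"
proof -
  have "recursive 1 (\<lambda>xs. rec_nat 0 (\<lambda>n y. (n # y # tl xs) ! 0) (hd xs))"
    unfolding One_nat_def by (intro recursive_primrec recursive_zero recursive_proj) simp_all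
  moreover have "rec_nat (0::nat) (\<lambda>n y. n) l = l - 1" for l by (cases l) auto
  ultimately show ?thesis
    by (elim recursive_cong) (simp add: nth_tl_hd)
qed

lemma recursive_monus: "recursive 2 (\<lambda>xs. xs ! 0 - xs ! 1)"
proof -
  have "recursive 2 (\<lambda>xs. rec_nat (tl xs ! 0) (\<lambda>n y. (n # y # tl xs) ! 1 - 1) (hd xs))"
    unfolding numeral_2_eq_2
    by (intro recursive_primrec recursive_compose1[OF recursive_pred] recursive_proj) simp_all
  moreover have "rec_nat (m::nat) (\<lambda>n y. y - Suc 0) l = m - l" for m l by (induction l) auto
  ultimately have "recursive 2 (\<lambda>xs. xs ! 1 - xs ! 0)"
    by (elim recursive_cong) (simp add: nth_tl_hd numeral_2_eq_2)
  from recursive_compose2[OF this recursive_proj[of 1 2] recursive_proj[of 0 2]]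
  show ?thesis by simp
qed

lemma recursive_triangle: "recursive 1 (\<lambda>xs. triangle (xs ! 0))"
proof -
  have "recursive 1 (\<lambda>xs. rec_nat 0 (\<lambda>n y. (n # y # tl xs) ! 1 + Suc ((n # y # tl xs) ! 0)) (hd xs))"
    unfolding One_nat_def
    by (intro recursive_primrec recursive_compose2[OF recursive_add] recursive_zero recursive_Suc
        recursive_proj) simp_all
  moreover have "rec_nat (0::nat) (\<lambda>n y. Suc (y + n)) l = triangle l" for l by (induction l) auto
  ultimately show ?thesis
    by (elim recursive_cong) (simp add: nth_tl_hd)
qed

lemma recursive_pair: "recursive 2 (\<lambda>xs. prod_encode (xs ! 0, xs ! 1))"
  unfolding prod_encode_def prod.case
  by (intro recursive_compose2[OF recursive_add, where h = "\<lambda>xs. xs ! 0"]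
      recursive_compose1[OF recursive_triangle] recursive_add recursive_proj) simp

text \<open>A code lies in the diagonal preceding the first triangular number above it, and its
  offset in that diagonal is the first component.\<close>

lemma prod_decode_diagonal:
  fixes z :: nat
  defines "s \<equiv> (LEAST s. Suc z - triangle (Suc s) = 0)"
  shows "prod_decode z = (z - triangle s, s - (z - triangle s))"
proof -
  obtain m n where mn: "prod_decode z = (m, n)" by fastforce
  then have z: "z = triangle (m + n) + m"
    using prod_decode_inverse[of z] by (simp add: prod_encode_def)
  have mono: "triangle a \<le> triangle b" if "a \<le> b" for a b
    using that by (induction rule: dec_induct) auto
  have "s = m + n"
    unfolding s_def
  proof (rule Least_equality)
    fix y assume "Suc z - triangle (Suc y) = 0"
    then have "triangle (m + n) < triangle (Suc y)" using z by simp
    then show "m + n \<le> y" using mono[of "Suc y" "m + n"] by (meson not_less not_less_eq_eq)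
  qed (simp add: z)
  then show ?thesis using mn z by simp
qed

lemma recursive_unpair:
  "recursive 1 (\<lambda>xs. fst (prod_decode (xs ! 0)))" "recursive 1 (\<lambda>xs. snd (prod_decode (xs ! 0)))"
proof -
  have "recursive (Suc 1) (\<lambda>ys. Suc (ys ! 1) - triangle (Suc (ys ! 0)))"
    by (intro recursive_compose2[OF recursive_monus] recursive_compose1[OF recursive_triangle]
        recursive_Suc recursive_proj) simp_all
  moreover have "\<exists>n. Suc z - triangle (Suc n) = 0" for z
    by (rule exI[of _ z]) simp
  ultimately have "recursive 1 (\<lambda>xs. LEAST n. Suc ((n # xs) ! 1) - triangle (Suc ((n # xs) ! 0)) = 0)"
    by (intro recursive_Least) auto
  then have s: "recursive 1 (\<lambda>xs. LEAST n. Suc (xs ! 0) - triangle (Suc n) = 0)" by simp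
  have m: "recursive 1 (\<lambda>xs. xs ! 0 - triangle (LEAST n. Suc (xs ! 0) - triangle (Suc n) = 0))"
    by (intro recursive_compose2[OF recursive_monus] recursive_compose1[OF recursive_triangle] s
        recursive_proj) simp
  show "recursive 1 (\<lambda>xs. fst (prod_decode (xs ! 0)))"
    unfolding prod_decode_diagonal fst_conv by (rule m)
  show "recursive 1 (\<lambda>xs. snd (prod_decode (xs ! 0)))"
    unfolding prod_decode_diagonal snd_conv by (intro recursive_compose2[OF recursive_monus] s m)
qed

section \<open>Computable functions on encoded types\<close>

text \<open>The instances reproduce the codings of the definitions that the theorem refers to: letters, words and
tuples of words are coded by \<open>encode\<close> at the types of pairs and lists.\<close>

class coded =
  fixes encode :: "'a \<Rightarrow> nat"
  assumes encode_eq [simp]: "encode x = encode y \<longleftrightarrow> x = y"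

instantiation nat :: coded
begin
definition "encode_nat = (id :: nat \<Rightarrow> nat)"
instance by standard (simp add: encode_nat_def)
end

instantiation bool :: coded
begin
definition "encode_bool = (of_bool :: bool \<Rightarrow> nat)"
instance by standard (simp add: encode_bool_def)
end

instantiation prod :: (coded, coded) coded
begin
definition "encode_prod = prod_encode \<circ> map_prod encode encode"
instance by standard (auto simp: encode_prod_def)
end

instantiation list :: (coded) coded
begin
definition "encode_list = list_encode \<circ> map encode"
instance
proof
  have "inj (encode :: 'a \<Rightarrow> nat)" by (rule injI) simp
  then show "encode xs = encode ys \<longleftrightarrow> xs = ys" for xs ys :: "'a list"
    by (simp add: encode_list_def list_encode_eq inj_map_eq_map)
qed
end

lemma encode_simps [simp]:
  "encode (n :: nat) = n"
  "encode (b :: bool) = of_bool b"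
  "encode (x, y) = prod_encode (encode x, encode y)"
  "encode [] = 0"
  "encode (x # xs) = Suc (prod_encode (encode x, encode xs))"
  by (simp_all add: encode_nat_def encode_bool_def encode_prod_def encode_list_def)

text \<open>The rules below follow the syntax of a function body. A subterm under a binder depends on the
surrounding argument \<open>x\<close> and on the bound variable; the rules turn it into a function of the
pair of the two, which is why premises mention \<open>fst p\<close> and \<open>snd p\<close>.\<close>

named_theorems computable_intros

text \<open>The function \<open>\<phi>\<close> is recursive and total on all numbers, including those that encode nothing.
This makes primitive recursion along a code possible, since it passes through all smaller numbers.\<close>

definition computable :: "('a::coded \<Rightarrow> 'b::coded) \<Rightarrow> bool" where
  "computable f \<longleftrightarrow>
     (\<exists>\<phi>. recursive 1 (\<lambda>xs. \<phi> (xs ! 0)) \<and> (\<forall>x. encode (f x) = \<phi> (encode x)))"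

lemma computableI:
  "recursive 1 (\<lambda>xs. \<phi> (xs ! 0)) \<Longrightarrow> (\<And>x. encode (f x) = \<phi> (encode x)) \<Longrightarrow> computable f"
  unfolding computable_def by blast

lemma recursive_const: "recursive k (\<lambda>xs. c)"
  by (induction c) (auto intro: recursive_zero recursive_Suc)

lemma computable_const [computable_intros]: "computable (\<lambda>x. c)"
  by (rule computableI[OF recursive_const]) simp

lemma computable_id [computable_intros]: "computable (\<lambda>x. x)"
  by (rule computableI[where \<phi> = "\<lambda>z. z", OF recursive_proj]) simp_all

lemma computable_compose:
  assumes "computable f" "computable g"
  shows "computable (\<lambda>x. f (g x))"
proof -
  obtain \<phi> where \<phi>: "recursive 1 (\<lambda>xs. \<phi> (xs ! 0))" "\<And>x. encode (f x) = \<phi> (encode x)"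
    using assms(1) unfolding computable_def by blast
  obtain \<gamma> where \<gamma>: "recursive 1 (\<lambda>xs. \<gamma> (xs ! 0))" "\<And>x. encode (g x) = \<gamma> (encode x)"
    using assms(2) unfolding computable_def by blast
  show ?thesis
    by (rule computableI[OF recursive_compose1[OF \<phi>(1) \<gamma>(1)]]) (simp add: \<phi>(2) \<gamma>(2))
qed

lemma computable_pair [computable_intros]:
  assumes "computable f" "computable g"
  shows "computable (\<lambda>x. (f x, g x))"
proof -
  obtain \<phi> where \<phi>: "recursive 1 (\<lambda>xs. \<phi> (xs ! 0))" "\<And>x. encode (f x) = \<phi> (encode x)"
    using assms(1) unfolding computable_def by blast
  obtain \<gamma> where \<gamma>: "recursive 1 (\<lambda>xs. \<gamma> (xs ! 0))" "\<And>x. encode (g x) = \<gamma> (encode x)"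
    using assms(2) unfolding computable_def by blast
  show ?thesis
    by (rule computableI[OF recursive_compose2[OF recursive_pair \<phi>(1) \<gamma>(1)]]) (simp add: \<phi>(2) \<gamma>(2))
qed

lemma computable_fst [computable_intros]: "computable f \<Longrightarrow> computable (\<lambda>x. fst (f x))"
  by (rule computable_compose[rotated], assumption, rule computableI[OF recursive_unpair(1)]) auto

lemma computable_snd [computable_intros]: "computable f \<Longrightarrow> computable (\<lambda>x. snd (f x))"
  by (rule computable_compose[rotated], assumption, rule computableI[OF recursive_unpair(2)]) auto

lemma computable_compose2:
  assumes "computable (\<lambda>p. h (fst p) (snd p))" "computable f" "computable g"
  shows "computable (\<lambda>x. h (f x) (g x))"
  using computable_compose[OF assms(1) computable_pair[OF assms(2,3)]] by simp

lemma computable_rec_nat [computable_intros]: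
  assumes "computable f" "computable (\<lambda>p. g (fst p) (fst (snd p)) (snd (snd p)))" "computable n"
  shows "computable (\<lambda>x. rec_nat (f x) (g x) (n x))"
proof -
  obtain \<phi> where \<phi>: "recursive 1 (\<lambda>xs. \<phi> (xs ! 0))" "\<And>x. encode (f x) = \<phi> (encode x)"
    using assms(1) unfolding computable_def by blast
  obtain \<gamma> where \<gamma>: "recursive 1 (\<lambda>xs. \<gamma> (xs ! 0))"
      "\<And>p. encode (g (fst p) (fst (snd p)) (snd (snd p))) = \<gamma> (encode p)"
    using assms(2) unfolding computable_def by blast
  have \<gamma>': "encode (g x k y) = \<gamma> (prod_encode (encode x, prod_encode (k, encode y)))" for x k y
    using \<gamma>(2)[of "(x, k, y)"] by simp
  obtain \<nu> where \<nu>: "recursive 1 (\<lambda>xs. \<nu> (xs ! 0))" "\<And>x. encode (n x) = \<nu> (encode x)"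
    using assms(3) unfolding computable_def by blast
  let ?R = "\<lambda>k z. rec_nat (\<phi> z) (\<lambda>k y. \<gamma> (prod_encode (z, prod_encode (k, y)))) k"
  have \<phi>': "recursive 1 (\<lambda>xs. \<phi> (xs ! 0))" by (rule \<phi>(1))
  have "recursive (Suc (Suc 1)) (\<lambda>xs. \<gamma> (prod_encode (xs ! 2, prod_encode (xs ! 0, xs ! 1))))"
    by (intro recursive_compose1[OF \<gamma>(1)] recursive_compose2[OF recursive_pair] recursive_proj) simp_all
  from recursive_primrec[OF \<phi>' this]
  have "recursive 2 (\<lambda>xs. ?R (xs ! 0) (xs ! 1))"
    unfolding numeral_2_eq_2 One_nat_def by (rule recursive_cong) (simp add: nth_tl_hd numeral_2_eq_2)
  then have "recursive 1 (\<lambda>xs. ?R (\<nu> (xs ! 0)) (xs ! 0))"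
    by (rule recursive_compose2[OF _ \<nu>(1)]) (simp add: recursive_proj)
  moreover have "encode (rec_nat (f x) (g x) k) = ?R k (encode x)" for x k
    by (induction k) (simp_all add: \<phi>(2) \<gamma>')
  ultimately show ?thesis
    by (intro computableI[where \<phi> = "\<lambda>z. ?R (\<nu> z) z"]) (simp_all flip: \<nu>(2))
qed

lemma computable_of_bool: "computable (\<lambda>b. of_bool b :: nat)"
  by (rule computableI[where \<phi> = "\<lambda>z. z", OF recursive_proj]) simp_all

lemma computable_If [computable_intros]:
  assumes "computable b" "computable f" "computable g"
  shows "computable (\<lambda>x. if b x then f x else g x)"
proof -
  have "computable (\<lambda>x. rec_nat (g x) (\<lambda>_ _. f x) (of_bool (b x)))"
    by (intro computable_rec_nat computable_compose[OF computable_of_bool]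
        computable_compose[OF assms(2)] assms computable_fst computable_id)
  moreover have "rec_nat (g x) (\<lambda>_ _. f x) (of_bool (b x)) = (if b x then f x else g x)" for x by simp
  ultimately show ?thesis by simp
qed

text \<open>The code of a nonempty list is the successor of the code of the pair of its head and tail, so a
primitive recursion whose step ignores the previous value performs the case distinction.\<close>

lemma computable_case_list [computable_intros]:
  assumes "computable f" "computable (\<lambda>p. g (fst p) (fst (snd p)) (snd (snd p)))" "computable l"
  shows "computable (\<lambda>x. case l x of [] \<Rightarrow> f x | a # r \<Rightarrow> g x a r)"
proof -
  obtain \<phi> where \<phi>: "recursive 1 (\<lambda>xs. \<phi> (xs ! 0))" "\<And>x. encode (f x) = \<phi> (encode x)"
    using assms(1) unfolding computable_def by blast
  obtain \<gamma> where \<gamma>: "recursive 1 (\<lambda>xs. \<gamma> (xs ! 0))"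
      "\<And>p. encode (g (fst p) (fst (snd p)) (snd (snd p))) = \<gamma> (encode p)"
    using assms(2) unfolding computable_def by blast
  have \<gamma>': "encode (g x a r) = \<gamma> (prod_encode (encode x, prod_encode (encode a, encode r)))" for x a r
    using \<gamma>(2)[of "(x, a, r)"] by simp
  obtain \<zeta> where \<zeta>: "recursive 1 (\<lambda>xs. \<zeta> (xs ! 0))" "\<And>x. encode (l x) = \<zeta> (encode x)"
    using assms(3) unfolding computable_def by blast
  let ?R = "\<lambda>k z. rec_nat (\<phi> z) (\<lambda>k y. \<gamma> (prod_encode (z, k))) k"
  have "recursive (Suc (Suc 1)) (\<lambda>xs. \<gamma> (prod_encode (xs ! 2, xs ! 0)))"
    by (intro recursive_compose1[OF \<gamma>(1)] recursive_compose2[OF recursive_pair] recursive_proj) simp_all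
  from recursive_primrec[OF \<phi>(1) this]
  have "recursive 2 (\<lambda>xs. ?R (xs ! 0) (xs ! 1))"
    unfolding numeral_2_eq_2 One_nat_def by (rule recursive_cong) (simp add: nth_tl_hd numeral_2_eq_2)
  then have "recursive 1 (\<lambda>xs. ?R (\<zeta> (xs ! 0)) (xs ! 0))"
    by (rule recursive_compose2[OF _ \<zeta>(1)]) (simp add: recursive_proj)
  moreover have "encode (case l x of [] \<Rightarrow> f x | a # r \<Rightarrow> g x a r) = ?R (\<zeta> (encode x)) (encode x)" for x
    by (cases "l x") (simp_all add: \<phi>(2) \<gamma>' flip: \<zeta>(2))
  ultimately show ?thesis
    by (intro computableI[where \<phi> = "\<lambda>z. ?R (\<zeta> z) z"]) simp_all
qed

lemma computable_Cons [computable_intros]: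
  assumes "computable f" "computable g"
  shows "computable (\<lambda>x. f x # g x)"
proof -
  have "computable (\<lambda>p :: 'b \<times> 'b list. fst p # snd p)"
    by (rule computableI[where \<phi> = Suc, OF recursive_Suc[OF recursive_proj]]) auto
  then show ?thesis using assms by (rule computable_compose2[of "(#)" f g])
qed

section \<open>Arithmetic and comparison\<close>

lemma computable_binop:
  assumes "recursive 2 (\<lambda>xs. h (xs ! 0) (xs ! 1))" "computable f" "computable g"
  shows "computable (\<lambda>x. h (f x) (g x))"
proof -
  have "computable (\<lambda>p. h (fst p) (snd p))"
    by (rule computableI[where \<phi> = "\<lambda>z. h (fst (prod_decode z)) (snd (prod_decode z))",
          OF recursive_compose2[of h, OF assms(1) recursive_unpair]]) auto
  then show ?thesis using assms(2,3) by (rule computable_compose2[of h f g])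
qed

lemma computable_Suc [computable_intros]: "computable f \<Longrightarrow> computable (\<lambda>x. Suc (f x))"
  by (rule computable_compose[rotated], assumption,
      rule computableI[where \<phi> = Suc, OF recursive_Suc[OF recursive_proj]]) auto

lemmas computable_add [computable_intros] = computable_binop[OF recursive_add]
lemmas computable_minus [computable_intros] = computable_binop[OF recursive_monus]

lemma computable_mult [computable_intros]:
  assumes "computable f" "computable g"
  shows "computable (\<lambda>x. f x * g x :: nat)"
proof -
  have "computable (\<lambda>x. rec_nat 0 (\<lambda>_ y. y + g x) (f x))"
    by (intro computable_rec_nat computable_add computable_compose[OF assms(2)] assms(1)
        computable_fst computable_snd computable_id computable_const)
  moreover have "rec_nat 0 (\<lambda>_ y. y + m) n = n * m" for m n :: nat by (induction n) auto
  ultimately show ?thesis by simp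
qed

lemma computable_is_zero: "computable (\<lambda>n::nat. n = 0)"
  by (rule computableI[where \<phi> = "\<lambda>z. 1 - z",
        OF recursive_compose2[OF recursive_monus recursive_const recursive_proj]]) auto

lemma computable_eq_nat: "computable f \<Longrightarrow> computable g \<Longrightarrow> computable (\<lambda>x. f x = (g x :: nat))"
proof -
  assume "computable f" "computable g"
  then have "computable (\<lambda>x. (f x - g x) + (g x - f x) = 0)"
    by (intro computable_compose[OF computable_is_zero] computable_intros)
  then show ?thesis by (elim back_subst[of computable]) auto
qed

lemma computable_encode: "computable f \<Longrightarrow> computable (\<lambda>x. encode (f x))"
  by (rule computable_compose[rotated], assumption,
      rule computableI[where \<phi> = "\<lambda>z. z", OF recursive_proj]) auto

lemma computable_eq [computable_intros]: "computable f \<Longrightarrow> computable g \<Longrightarrow> computable (\<lambda>x. f x = g x)"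
proof -
  assume "computable f" "computable g"
  then have "computable (\<lambda>x. encode (f x) = encode (g x))"
    by (intro computable_eq_nat computable_encode)
  then show ?thesis by simp
qed

lemma computable_le [computable_intros]: "computable f \<Longrightarrow> computable g \<Longrightarrow> computable (\<lambda>x. f x \<le> (g x :: nat))"
  unfolding diff_is_0_eq[symmetric] by (intro computable_intros)

lemma computable_less [computable_intros]: "computable f \<Longrightarrow> computable g \<Longrightarrow> computable (\<lambda>x. f x < (g x :: nat))"
  unfolding less_eq_Suc_le by (intro computable_intros)

lemma computable_not [computable_intros]: "computable b \<Longrightarrow> computable (\<lambda>x. \<not> b x)"
proof -
  assume "computable b"
  then have "computable (\<lambda>x. if b x then False else True)" by (intro computable_intros)
  then show ?thesis by (elim back_subst[of computable]) auto
qed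

lemma computable_conj [computable_intros]: "computable b \<Longrightarrow> computable c \<Longrightarrow> computable (\<lambda>x. b x \<and> c x)"
proof -
  assume "computable b" "computable c"
  then have "computable (\<lambda>x. if b x then c x else False)" by (intro computable_intros)
  then show ?thesis by (elim back_subst[of computable]) auto
qed

lemma computable_disj [computable_intros]: "computable b \<Longrightarrow> computable c \<Longrightarrow> computable (\<lambda>x. b x \<or> c x)"
proof -
  assume "computable b" "computable c"
  then have "computable (\<lambda>x. if b x then True else c x)" by (intro computable_intros)
  then show ?thesis by (elim back_subst[of computable]) auto
qed

lemma computable_imp [computable_intros]: "computable b \<Longrightarrow> computable c \<Longrightarrow> computable (\<lambda>x. b x \<longrightarrow> c x)"
  unfolding imp_conv_disj by (intro computable_intros)

section \<open>Computable functions on lists\<close>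

text \<open>A code bounds the length of the list it encodes, so iterating the step function as often as
  the code says exhausts the list.\<close>

lemma length_le_encode: "length xs \<le> encode xs"
proof (induction xs)
  case (Cons x xs)
  then show ?case using le_prod_encode_2[of "encode xs" "encode x"] by simp
qed simp

lemma fold_by_iteration:
  fixes g :: "'a \<Rightarrow> 'b \<Rightarrow> 'b"
  defines "step \<equiv> (\<lambda>p. case fst p of [] \<Rightarrow> p | a # r \<Rightarrow> (r, g a (snd p)))"
  assumes "length xs \<le> n"
  shows "rec_nat (xs, s) (\<lambda>_. step) n = ([], fold g xs s)"
proof -
  have "(step ^^ n) (xs, s) = ([], fold g xs s)" using assms(2)
  proof (induction n arbitrary: xs s)
    case (Suc n)
    have 0: "(step ^^ m) ([], s) = ([], s)" for m by (induction m) (auto simp: step_def)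
    show ?case
    proof (cases xs)
      case Nil
      then show ?thesis using 0[of "Suc n"] by simp
    next
      case (Cons a r)
      then have "(step ^^ Suc n) (xs, s) = (step ^^ n) (r, g a s)"
        by (simp add: funpow_Suc_right step_def del: funpow.simps)
      then show ?thesis using Suc Cons by simp
    qed
  qed simp
  moreover have "rec_nat q (\<lambda>_. step) n = (step ^^ n) q" for q by (induction n) auto
  ultimately show ?thesis by simp
qed

lemma computable_fold [computable_intros]:
  assumes g: "computable (\<lambda>p. g (fst p) (fst (snd p)) (snd (snd p)))"
    and l: "computable l" and i: "computable i"
  shows "computable (\<lambda>x. fold (g x) (l x) (i x))"
proof -
  \<comment> \<open>The state consists of the rest of the list and the accumulator; the code of the list serves as the
    number of iterations.\<close>
  have "computable (\<lambda>x. snd (rec_nat (l x, i x)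
      (\<lambda>_ p. case fst p of [] \<Rightarrow> p | a # r \<Rightarrow> (r, g x a (snd p))) (encode (l x))))"
    by (intro computable_snd computable_rec_nat computable_pair computable_case_list l i
        computable_encode computable_compose[OF g, of "\<lambda>q. (fst (fst q), fst (snd q), snd (snd (snd (fst q))))",
          unfolded fst_conv snd_conv]
        computable_snd computable_fst computable_id)
  then show ?thesis by (simp add: fold_by_iteration length_le_encode)
qed

lemma computable_rev [computable_intros]: "computable l \<Longrightarrow> computable (\<lambda>x. rev (l x))"
proof -
  assume "computable l"
  then have "computable (\<lambda>x. fold Cons (l x) [])" by (intro computable_intros)
  then show ?thesis by (simp add: fold_Cons_rev)
qed

lemma computable_foldr [computable_intros]:
  assumes "computable (\<lambda>p. g (fst p) (fst (snd p)) (snd (snd p)))" "computable l" "computable i"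
  shows "computable (\<lambda>x. foldr (g x) (l x) (i x))"
  unfolding foldr_conv_fold by (intro computable_fold computable_rev assms)

lemma computable_append [computable_intros]:
  assumes "computable f" "computable g"
  shows "computable (\<lambda>x. f x @ g x)"
proof -
  have "computable (\<lambda>x. foldr Cons (f x) (g x))" by (intro computable_intros assms)
  moreover have "foldr Cons u v = u @ v" for u v :: "'b list" by (induction u) auto
  ultimately show ?thesis by simp
qed

lemma computable_map [computable_intros]:
  assumes "computable (\<lambda>p. g (fst p) (snd p))" "computable l"
  shows "computable (\<lambda>x. map (g x) (l x))"
proof -
  have "computable (\<lambda>x. foldr (\<lambda>a s. g x a # s) (l x) [])"
    by (intro computable_compose2[of g, OF assms(1)] computable_intros assms(2))
  moreover have "foldr (\<lambda>a s. h a # s) u [] = map h u" for h :: "'b \<Rightarrow> 'c" and u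
    by (induction u) auto
  ultimately show ?thesis by simp
qed

lemma computable_filter [computable_intros]:
  assumes "computable (\<lambda>p. P (fst p) (snd p))" "computable l"
  shows "computable (\<lambda>x. filter (P x) (l x))"
proof -
  have "computable (\<lambda>x. foldr (\<lambda>a s. if P x a then a # s else s) (l x) [])"
    by (intro computable_compose2[of P, OF assms(1)] computable_intros assms(2))
  moreover have "foldr (\<lambda>a s. if Q a then a # s else s) u [] = filter Q u" for Q :: "'b \<Rightarrow> bool" and u
    by (induction u) auto
  ultimately show ?thesis by simp
qed

lemma computable_concat [computable_intros]: "computable l \<Longrightarrow> computable (\<lambda>x. concat (l x))"
  unfolding concat_conv_foldr by (intro computable_intros)

lemma computable_length [computable_intros]:
  fixes l :: "'a::coded \<Rightarrow> 'b::coded list"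
  assumes "computable l"
  shows "computable (\<lambda>x. length (l x))"
proof -
  have "computable (\<lambda>x. foldr (\<lambda>_ s. Suc s) (l x) 0)" by (intro computable_intros assms)
  moreover have "foldr (\<lambda>_ s. Suc s) u 0 = length u" for u :: "'b list" by (induction u) auto
  ultimately show ?thesis by simp
qed

lemma computable_Bex [computable_intros]:
  assumes "computable (\<lambda>p. P (fst p) (snd p))" "computable l"
  shows "computable (\<lambda>x. \<exists>a\<in>set (l x). P x a)"
proof -
  have "computable (\<lambda>x. foldr (\<lambda>a s. P x a \<or> s) (l x) False)"
    by (intro computable_compose2[of P, OF assms(1)] computable_intros assms(2))
  moreover have "foldr (\<lambda>a s. Q a \<or> s) u False \<longleftrightarrow> (\<exists>a\<in>set u. Q a)" for Q :: "'b \<Rightarrow> bool" and u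
    by (induction u) auto
  ultimately show ?thesis by simp
qed

lemma computable_Ball [computable_intros]:
  assumes "computable (\<lambda>p. P (fst p) (snd p))" "computable l"
  shows "computable (\<lambda>x. \<forall>a\<in>set (l x). P x a)"
proof -
  have "computable (\<lambda>x. \<not> (\<exists>a\<in>set (l x). \<not> P x a))"
    by (intro computable_compose2[of P, OF assms(1)] computable_intros assms(2))
  then show ?thesis by simp
qed

lemma computable_member [computable_intros]:
  assumes "computable f" "computable l"
  shows "computable (\<lambda>x. f x \<in> set (l x))"
proof -
  have "computable (\<lambda>x. \<exists>a\<in>set (l x). a = f x)"
    by (intro computable_intros computable_compose[OF assms(1)] assms(2))
  then show ?thesis by simp
qed

lemma computable_remdups [computable_intros]:
  fixes l :: "'a::coded \<Rightarrow> 'b::coded list"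
  assumes "computable l"
  shows "computable (\<lambda>x. remdups (l x))"
proof -
  have "computable (\<lambda>x. foldr (\<lambda>a s. if a \<in> set s then s else a # s) (l x) [])"
    by (intro computable_intros assms)
  moreover have "foldr (\<lambda>a s. if a \<in> set s then s else a # s) u [] = remdups u" for u :: "'b list"
    by (induction u) simp_all
  ultimately show ?thesis by simp
qed

lemma computable_subseqs [computable_intros]:
  fixes l :: "'a::coded \<Rightarrow> 'b::coded list"
  assumes "computable l"
  shows "computable (\<lambda>x. subseqs (l x))"
proof -
  have "computable (\<lambda>x. foldr (\<lambda>a s. map (Cons a) s @ s) (l x) [[]])"
    by (intro computable_intros assms)
  moreover have "foldr (\<lambda>a s. map (Cons a) s @ s) u [[]] = subseqs u" for u :: "'b list"
    by (induction u) (auto simp: Let_def)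
  ultimately show ?thesis by simp
qed

lemma computable_upt [computable_intros]:
  assumes "computable n"
  shows "computable (\<lambda>x. [0..<n x])"
proof -
  have "computable (\<lambda>x. rec_nat [] (\<lambda>k s. s @ [k]) (n x))" by (intro computable_intros assms)
  moreover have "rec_nat [] (\<lambda>k s. s @ [k]) m = [0..<m]" for m by (induction m) auto
  ultimately show ?thesis by simp
qed

text \<open>Bounded search is total on all numbers, so it stays within the computable functions; unbounded
search, below, need not terminate on arguments that encode nothing.\<close>

definition least_below :: "nat \<Rightarrow> (nat \<Rightarrow> bool) \<Rightarrow> nat" where
  "least_below m P = (case filter P [0..<m] of [] \<Rightarrow> m | k # _ \<Rightarrow> k)"

lemma least_below_eqI:
  assumes "k < m" "P k" "\<And>j. P j \<Longrightarrow> k \<le> j"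
  shows "least_below m P = k"
proof (cases "filter P [0..<m]")
  case Nil
  then show ?thesis using assms(1,2) by (auto simp: filter_empty_conv)
next
  case (Cons a r)
  have "sorted (a # r)" unfolding Cons[symmetric] by (intro sorted_wrt_filter sorted_upt)
  moreover have "set (a # r) = {j. j < m \<and> P j}" unfolding Cons[symmetric] by auto
  ultimately have "a \<le> k" "P a" using assms(1,2) by auto
  then show ?thesis using assms(3)[of a] Cons by (simp add: least_below_def)
qed

lemma computable_least_below [computable_intros]:
  assumes "computable (\<lambda>p. P (fst p) (snd p))" "computable m"
  shows "computable (\<lambda>x. least_below (m x) (P x))"
  unfolding least_below_def
  by (intro computable_compose2[of P, OF assms(1)] computable_compose[OF assms(2)] computable_intros)

section \<open>Unbounded search\<close>

text \<open>
Minimization is the only partial operation and is needed once, as the first step: its result is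
handed to a total function. Therefore the search has to succeed on \<open>D\<close> only.\<close>

lemma computable_on_Least:
  assumes P: "computable (\<lambda>p. P (fst p) (snd p))" and f: "computable f"
    and ex: "\<And>x. x \<in> D \<Longrightarrow> \<exists>n. P x n"
  shows "computable_on encode encode D (\<lambda>x. f (x, LEAST n :: nat. P x n))"
proof -
  obtain \<pi> where \<pi>: "recursive 1 (\<lambda>xs. \<pi> (xs ! 0))"
      "\<And>p. encode (P (fst p) (snd p)) = \<pi> (encode p)"
    using P unfolding computable_def by blast
  obtain \<phi> where \<phi>: "recursive 1 (\<lambda>xs. \<phi> (xs ! 0))" "\<And>p. encode (f p) = \<phi> (encode p)"
    using f unfolding computable_def by blast
  have \<pi>': "\<pi> (prod_encode (encode x, n)) = of_bool (P x n)" for x n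
    using \<pi>(2)[of "(x, n)"] by simp
  have \<phi>': "\<phi> (prod_encode (encode x, n)) = encode (f (x, n))" for x n
    using \<phi>(2)[of "(x, n)"] by simp
  have "recursive 2 (\<lambda>xs. 1 - \<pi> (prod_encode (xs ! 1, xs ! 0)))"
    by (intro recursive_compose2[OF recursive_monus] recursive_const recursive_compose1[OF \<pi>(1)]
        recursive_compose2[OF recursive_pair] recursive_proj) simp_all
  then obtain e where e: "\<And>xs. length xs = 2 \<Longrightarrow> evals e xs (1 - \<pi> (prod_encode (xs ! 1, xs ! 0)))"
    unfolding recursive_def by blast
  have "recursive 2 (\<lambda>xs. \<phi> (prod_encode (xs ! 0, xs ! 1)))"
    by (intro recursive_compose1[OF \<phi>(1)] recursive_pair)
  then obtain e' where e': "\<And>xs. length xs = 2 \<Longrightarrow> evals e' xs (\<phi> (prod_encode (xs ! 0, xs ! 1)))"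
    unfolding recursive_def by blast
  have "evals (Comp e' [Proj 0, Mu e]) [encode x] (encode (f (x, LEAST n. P x n)))" if "x \<in> D" for x
  proof (rule evals_Comp[where ys = "[encode x, LEAST n. P x n]"])
    have "evals (Mu e) [encode x] (LEAST n. P x n)"
    proof (rule evals_Mu)
      show "evals e [LEAST n. P x n, encode x] 0"
        using e[of "[LEAST n. P x n, encode x]"] LeastI_ex[OF ex[OF that]] by (simp add: \<pi>')
      show "\<forall>j<LEAST n. P x n. \<exists>y. evals e [j, encode x] (Suc y)"
      proof (intro allI impI)
        fix j assume "j < (LEAST n. P x n)"
        then have "\<not> P x j" by (rule not_less_Least)
        then show "\<exists>y. evals e [j, encode x] (Suc y)" using e[of "[j, encode x]"] by (auto simp: \<pi>')
      qed
    qed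
    moreover have "evals (Proj 0) [encode x] (encode x)" using evals_Proj[of 0 "[encode x]"] by simp
    ultimately show "\<forall>i<length [Proj 0, Mu e]. evals ([Proj 0, Mu e] ! i) [encode x]
        ([encode x, LEAST n. P x n] ! i)"
      by (simp add: less_Suc_eq)
    show "evals e' [encode x, LEAST n. P x n] (encode (f (x, LEAST n. P x n)))"
      using e'[of "[encode x, LEAST n. P x n]"] by (simp add: \<phi>')
  qed simp
  then show ?thesis unfolding computable_on_def by blast
qed

section \<open>Reduced words and the free group\<close>

definition word_inv :: "'a word \<Rightarrow> 'a word" where
  "word_inv w = rev (map inv_letter w)"

definition word_mult :: "'a word \<Rightarrow> 'a word \<Rightarrow> 'a word" (infixl \<open>\<star>\<close> 70) where
  "u \<star> v = reduce (u @ v)"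

lemma inv_letter_involution [simp]: "inv_letter (inv_letter a) = a"
  by (simp add: inv_letter_def)

lemma inv_letter_neq [simp]: "inv_letter a \<noteq> a"
  by (cases a) (simp add: inv_letter_def)

lemma inv_letter_eq_iff [simp]: "inv_letter a = inv_letter b \<longleftrightarrow> a = b"
  by (metis inv_letter_involution)

lemma fst_inv_letter [simp]: "fst (inv_letter a) = fst a"
  by (simp add: inv_letter_def)

lemma word_inv_simps [simp]:
  "word_inv [] = []" "word_inv (u @ v) = word_inv v @ word_inv u" "word_inv (word_inv w) = w"
  "word_inv (a # w) = word_inv w @ [inv_letter a]" "length (word_inv w) = length w"
  by (simp_all add: word_inv_def rev_map comp_def)

lemma letters_word_inv [simp]: "fst ` set (word_inv w) = fst ` set w"
  by (simp add: word_inv_def image_image)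

lemma word_inv_eq_iff [simp]: "word_inv u = word_inv v \<longleftrightarrow> u = v"
  by (metis word_inv_simps(3))

lemma word_inv_Nil_iff [simp]: "word_inv w = [] \<longleftrightarrow> w = []"
  by (simp add: word_inv_def)

lemma reduced_Nil [simp]: "reduced []"
  and reduced_Cons: "reduced (a # w) \<longleftrightarrow> reduced w \<and> (w \<noteq> [] \<longrightarrow> hd w \<noteq> inv_letter a)"
  by (cases w; auto simp: reduced_def)+

lemma reduced_append:
  "reduced (u @ v) \<longleftrightarrow>
    reduced u \<and> reduced v \<and> (u \<noteq> [] \<longrightarrow> v \<noteq> [] \<longrightarrow> hd v \<noteq> inv_letter (last u))"
  by (auto simp: reduced_def successively_append_iff)

lemma reduced_word_inv [simp]: "reduced (word_inv w) \<longleftrightarrow> reduced w"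
proof -
  have "reduced (word_inv w)" if "reduced w" for w :: "'a word"
    using that
  proof (induction w)
    case (Cons a w)
    then show ?case
      by (cases w) (auto simp: reduced_append reduced_Cons)
  qed simp
  then show ?thesis by (metis word_inv_simps(3))
qed

lemma reduced_append_overlap:
  "reduced (a @ t) \<Longrightarrow> reduced (t @ s) \<Longrightarrow> t \<noteq> [] \<Longrightarrow> reduced (a @ t @ s)"
  by (auto simp: reduced_append)

lemma reduced_cons_cancel: "reduced w \<Longrightarrow> reduced (cons_cancel a w)"
  by (cases w) (auto simp: reduced_Cons)

lemma reduced_foldr: "reduced w \<Longrightarrow> reduced (foldr cons_cancel u w)"
  by (induction u) (auto simp: reduced_cons_cancel)

lemma reduced_reduce [simp]: "reduced (reduce w)"
  by (simp add: reduce_def reduced_foldr)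

lemma reduced_word_mult [simp]: "reduced (u \<star> v)"
  by (simp add: word_mult_def)

lemma cons_cancel_inverse: "reduced w \<Longrightarrow> cons_cancel a (cons_cancel (inv_letter a) w) = w"
proof (cases w)
  case (Cons b v)
  then show "reduced w \<Longrightarrow> ?thesis" by (cases v) (auto simp: reduced_Cons)
qed simp

lemma reduce_Cons: "reduce (a # w) = cons_cancel a (reduce w)"
  by (simp add: reduce_def)

lemma reduce_Nil [simp]: "reduce [] = []"
  by (simp add: reduce_def)

lemma reduce_append: "reduce (u @ v) = foldr cons_cancel u (reduce v)"
  by (simp add: reduce_def)

lemma reduce_reduced [simp]: "reduced w \<Longrightarrow> reduce w = w"
proof (induction w)
  case (Cons a w)
  then show ?case by (cases w) (auto simp: reduce_Cons reduced_Cons)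
qed simp

lemma reduce_cancel_letter: "reduce (a # inv_letter a # w) = reduce w"
  by (simp add: reduce_Cons cons_cancel_inverse)

lemma reduce_cons_cancel_append: "reduce (cons_cancel a u @ v) = cons_cancel a (reduce (u @ v))"
  by (cases u) (auto simp: reduce_Cons cons_cancel_inverse)

lemma reduce_append_left [simp]: "reduce (reduce u @ v) = reduce (u @ v)"
  by (induction u) (simp_all add: reduce_Cons reduce_cons_cancel_append)

lemma reduce_append_right [simp]: "reduce (u @ reduce v) = reduce (u @ v)"
  by (simp add: reduce_append)

lemma reduce_cancel: "reduce (u @ word_inv p @ p @ v) = reduce (u @ v)"
proof (induction p arbitrary: v)
  case (Cons a p)
  have "reduce (u @ word_inv (a # p) @ (a # p) @ v)
      = reduce ((u @ word_inv p) @ reduce (inv_letter a # a # (p @ v)))"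
    using reduce_append_right[of "u @ word_inv p" "inv_letter a # a # (p @ v)"]
    by (simp del: reduce_append_right)
  also have "\<dots> = reduce (u @ word_inv p @ p @ v)"
    using reduce_cancel_letter[of "inv_letter a" "p @ v"]
      reduce_append_right[of "u @ word_inv p" "p @ v"] by simp
  finally show ?case using Cons by simp
qed simp

lemma word_mult_assoc: "(u \<star> v) \<star> w = u \<star> (v \<star> w)"
  by (simp add: word_mult_def)

lemma word_mult_inv [simp]: "word_inv w \<star> w = []" "w \<star> word_inv w = []"
  using reduce_cancel[of "[]" w "[]"] reduce_cancel[of "[]" "word_inv w" "[]"]
  by (simp_all add: word_mult_def)

lemma word_mult_Nil [simp]: "reduced w \<Longrightarrow> w \<star> [] = w" "reduced w \<Longrightarrow> [] \<star> w = w"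
  by (simp_all add: word_mult_def)

text \<open>
All statements about lengths of products below are read off from this form of the product: the two
words cancel at the seam only, where the end of \<open>u\<close> is inverse to the beginning \<open>p\<close> of \<open>v\<close>.\<close>

lemma cancellation:
  assumes "reduced u" "reduced v"
  obtains a p b where "u = a @ word_inv p" "v = p @ b" "u \<star> v = a @ b" "reduced (a @ b)"
proof -
  have "\<exists>a p b. u = a @ word_inv p \<and> v = p @ b \<and> reduced (a @ b)"
    using assms
  proof (induction v arbitrary: u)
    case (Cons y v)
    show ?case
    proof (cases "u \<noteq> [] \<and> y = inv_letter (last u)")
      case False
      then have "reduced (u @ y # v)" using Cons.prems by (auto simp: reduced_append)
      then show ?thesis by (intro exI[of _ u] exI[of _ "[]"] exI[of _ "y # v"]) simp
    next
      case True
      then obtain u' where u: "u = u' @ [inv_letter y]"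
        by (metis append_butlast_last_id inv_letter_involution)
      then obtain a p b where "u' = a @ word_inv p" "v = p @ b" "reduced (a @ b)"
        using Cons.IH[of u'] Cons.prems by (auto simp: reduced_append reduced_Cons)
      then show ?thesis by (intro exI[of _ a] exI[of _ "y # p"] exI[of _ b]) (simp add: u)
    qed
  qed (auto intro: exI[of _ "[]"])
  then obtain a p b where "u = a @ word_inv p" "v = p @ b" "reduced (a @ b)" by blast
  then show ?thesis using that reduce_cancel[of a p b] by (simp add: word_mult_def)
qed

lemma word_inv_word_mult: "word_inv (u \<star> v) = word_inv v \<star> word_inv u"
proof -
  have "word_inv (reduce w) = reduce (word_inv w)" for w :: "'a word"
  proof (induction w)
    case (Cons a w)
    have *: "word_inv (cons_cancel a r) = reduce (word_inv r @ [inv_letter a])" if "reduced r" for r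
    proof (cases r)
      case (Cons b r')
      show ?thesis
      proof (cases "b = inv_letter a")
        case True
        then show ?thesis
          using that Cons reduce_cancel[of "word_inv r'" "[inv_letter a]" "[]"]
          by (simp add: reduced_Cons)
      next
        case False
        then have "reduced (a # r)" using that Cons by (simp add: reduced_Cons)
        then have "reduced (word_inv (a # r))" by (simp only: reduced_word_inv)
        then show ?thesis using Cons False by simp
      qed
    qed (simp add: reduced_Cons)
    show ?case using *[of "reduce w"] Cons by (simp add: reduce_Cons)
  qed simp
  then show ?thesis by (simp add: word_mult_def)
qed

text \<open>Otherwise the middle of the word would be a letter, or a pair of adjacent letters, that is
  inverse to itself.\<close>

lemma cancel_self_less_half:
  assumes "reduced w" "w = p @ b" "w = a @ word_inv p" "w \<noteq> []"
  shows "2 * length p < length w"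
proof (rule ccontr)
  assume "\<not> 2 * length p < length w"
  moreover define n where "n = length w"
  ultimately have n: "n \<le> 2 * length p" "length p \<le> n" "0 < n" using assms by auto
  have nth: "w ! (n - 1 - i) = inv_letter (w ! i)" if "i < length p" for i
  proof -
    have "w ! (n - 1 - i) = word_inv p ! (length p - 1 - i)"
      using that n assms(3) by (auto simp: n_def nth_append Suc_diff_Suc)
    also have "\<dots> = inv_letter (p ! i)" using that by (simp add: word_inv_def rev_nth)
    also have "p ! i = w ! i" using that assms(2) by (simp add: nth_append)
    finally show ?thesis .
  qed
  show False
  proof (cases "odd n")
    case True
    then have "n div 2 < length p" "n - 1 - n div 2 = n div 2" using n by presburger+
    then show False using nth[of "n div 2"] by (metis inv_letter_neq)
  next
    case False
    then obtain k where "n = 2 * k" by (auto elim: evenE)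
    with n obtain i where "n = 2 * Suc i" by (cases k) auto
    then have "i < length p" "n - Suc i = Suc i" "Suc i < n" using n by auto
    moreover have "w ! Suc i \<noteq> inv_letter (w ! i)" if "Suc i < n" for i
      using assms(1) that unfolding reduced_def n_def by (simp add: successively_conv_nth)
    ultimately show False using nth[of i] by simp
  qed
qed

lemma word_inv_neq: "reduced w \<Longrightarrow> w \<noteq> [] \<Longrightarrow> word_inv w \<noteq> w"
  using cancel_self_less_half[of w w "[]" "[]"] by auto

lemma length_word_mult_self: "reduced w \<Longrightarrow> length w \<le> length (w \<star> w)"
proof -
  assume w: "reduced w"
  then obtain a p b where "w = a @ word_inv p" "w = p @ b" "w \<star> w = a @ b"
    using cancellation by metis
  moreover from this have "length w = length a + length p" "length w = length p + length b"
    by (metis length_append word_inv_simps(5))+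
  ultimately show ?thesis using cancel_self_less_half[OF w, of p b a] by (cases "w = []") auto
qed

lemma free_group_simps [simp]:
  "carrier (free_group X) = {w. reduced w \<and> fst ` set w \<subseteq> X}"
  "u \<otimes>\<^bsub>free_group X\<^esub> v = u \<star> v" "\<one>\<^bsub>free_group X\<^esub> = []"
  by (simp_all add: free_group_def word_mult_def)

lemma letters_reduce: "set (reduce w) \<subseteq> set w"
proof (induction w)
  case (Cons a w)
  have "set (cons_cancel a r) \<subseteq> insert a (set r)" for r by (cases r) auto
  then show ?case using Cons by (force simp: reduce_Cons)
qed simp

lemma letters_word_mult: "set (u \<star> v) \<subseteq> set u \<union> set v"
  using letters_reduce[of "u @ v"] by (simp add: word_mult_def)

lemma group_free_group: "group (free_group X)"
proof (rule groupI)
  fix u v assume "u \<in> carrier (free_group X)" "v \<in> carrier (free_group X)"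
  then have "fst ` set u \<union> fst ` set v \<subseteq> X" by simp
  with image_mono[OF letters_word_mult[of u v], of fst] have "fst ` set (u \<star> v) \<subseteq> X"
    by (simp only: image_Un)
  then show "u \<otimes>\<^bsub>free_group X\<^esub> v \<in> carrier (free_group X)" by simp
next
  fix u assume "u \<in> carrier (free_group X)"
  then show "\<exists>v\<in>carrier (free_group X). v \<otimes>\<^bsub>free_group X\<^esub> u = \<one>\<^bsub>free_group X\<^esub>"
    by (intro bexI[of _ "word_inv u"]) simp_all
qed (simp_all add: word_mult_assoc)

lemma inv_free_group: "w \<in> carrier (free_group X) \<Longrightarrow> inv\<^bsub>free_group X\<^esub> w = word_inv w"
  by (rule group.inv_equality[OF group_free_group]) simp_all

section \<open>Evaluating words in a group\<close>

definition letter_value :: "('g, 'b) monoid_scheme \<Rightarrow> 'g letter \<Rightarrow> 'g" where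
  "letter_value G a = (if snd a then fst a else inv\<^bsub>G\<^esub> (fst a))"

context group
begin

lemma word_value_Nil [simp]: "word_value G [] = \<one>"
  and word_value_Cons [simp]: "word_value G (a # w) = letter_value G a \<otimes> word_value G w"
  by (simp_all add: word_value_def letter_value_def case_prod_beta)

lemma letter_value_closed [simp]: "fst a \<in> carrier G \<Longrightarrow> letter_value G a \<in> carrier G"
  by (simp add: letter_value_def)

lemma word_value_closed: "fst ` set w \<subseteq> carrier G \<Longrightarrow> word_value G w \<in> carrier G"
  by (induction w) auto

lemma letter_value_inv: "fst a \<in> carrier G \<Longrightarrow> letter_value G (inv_letter a) = inv (letter_value G a)"
  by (simp add: letter_value_def inv_letter_def)

lemma word_value_append:
  "fst ` set u \<subseteq> carrier G \<Longrightarrow> fst ` set v \<subseteq> carrier G \<Longrightarrow>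
    word_value G (u @ v) = word_value G u \<otimes> word_value G v"
  by (induction u) (auto simp: word_value_closed m_assoc)

lemma word_value_cons_cancel:
  assumes "fst a \<in> carrier G" "fst ` set w \<subseteq> carrier G"
  shows "word_value G (cons_cancel a w) = letter_value G a \<otimes> word_value G w"
proof (cases w)
  case (Cons b v)
  then show ?thesis
    using assms inv_solve_left[of "letter_value G a"]
    by (auto simp: letter_value_inv m_assoc[symmetric] word_value_closed)
qed simp

lemma word_value_reduce:
  "fst ` set w \<subseteq> carrier G \<Longrightarrow> word_value G (reduce w) = word_value G w"
proof (induction w)
  case (Cons a w)
  then have "fst ` set (reduce w) \<subseteq> carrier G" using letters_reduce[of w] by auto
  then show ?case using Cons by (simp add: reduce_Cons word_value_cons_cancel)
qed simp

lemma word_value_hom: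
  assumes "B \<subseteq> carrier G"
  shows "word_value G \<in> hom (free_group B) G"
proof (rule homI)
  fix u v assume "u \<in> carrier (free_group B)" "v \<in> carrier (free_group B)"
  then have "fst ` set u \<subseteq> carrier G" "fst ` set v \<subseteq> carrier G" using assms by auto
  then show "word_value G (u \<otimes>\<^bsub>free_group B\<^esub> v) = word_value G u \<otimes> word_value G v"
    by (simp add: word_mult_def word_value_reduce word_value_append image_Un)
qed (use assms in \<open>auto intro!: word_value_closed\<close>)

lemma word_value_image:
  assumes "B \<subseteq> carrier G"
  shows "word_value G ` carrier (free_group B) = generate G B"
proof
  have "word_value G w \<in> generate G B" if "fst ` set w \<subseteq> B" for w
    using that
  proof (induction w)
    case (Cons a w)
    then show ?case
      by (auto simp: letter_value_def intro!: generate.eng intro: generate.incl generate.inv)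
  qed (simp add: generate.one)
  then show "word_value G ` carrier (free_group B) \<subseteq> generate G B" by auto
  interpret free: group "free_group B" by (rule group_free_group)
  show "generate G B \<subseteq> word_value G ` carrier (free_group B)"
  proof
    fix g assume "g \<in> generate G B"
    then show "g \<in> word_value G ` carrier (free_group B)"
    proof induction
      case one
      then show ?case by (force intro: image_eqI[of _ _ "[]"])
    next
      case (incl b)
      then show ?case using assms
        by (intro image_eqI[of _ _ "[(b, True)]"]) (auto simp: letter_value_def reduced_Cons)
    next
      case (inv b)
      then show ?case using assms
        by (intro image_eqI[of _ _ "[(b, False)]"]) (auto simp: letter_value_def reduced_Cons)
    next
      case (eng g h)
      then obtain u v where "g = word_value G u" "h = word_value G v"
        "u \<in> carrier (free_group B)" "v \<in> carrier (free_group B)" by blast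
      then show ?case
        using hom_mult[OF word_value_hom[OF assms], of u v] free.m_closed[of u v]
        by (metis image_eqI)
    qed
  qed
qed

end

section \<open>The rank of a group with a free basis\<close>

text \<open>
Counting the letters of a word that lie in a set \<open>T\<close> of basis elements modulo 2 is
a homomorphism to the group with two elements, and different sets \<open>T\<close> give different homomorphisms.
If \<open>S\<close> generates, a homomorphism is determined by its values on \<open>S\<close>, so the basis has at most as
many subsets as \<open>S\<close>.\<close>

definition parity :: "'a set \<Rightarrow> 'a word \<Rightarrow> bool" where
  "parity T w \<longleftrightarrow> odd (length (filter (\<lambda>a. fst a \<in> T) w))"

lemma parity_word_mult: "parity T (u \<star> v) \<longleftrightarrow> parity T u \<noteq> parity T v"
proof -
  have "parity T (reduce w) = parity T w" for w
  proof (induction w)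
    case (Cons a w)
    have "parity T (cons_cancel a r) = parity T (a # r)" for r
      by (cases r) (auto simp: parity_def)
    then show ?case using Cons by (simp add: reduce_Cons parity_def)
  qed simp
  then show ?thesis by (auto simp: word_mult_def parity_def)
qed

lemma (in group) free_basis_card_le:
  assumes B: "free_basis G B" and "finite B"
    and S: "finite S" "S \<subseteq> carrier G" "generate G S = carrier G"
  shows "card B \<le> card S"
proof -
  interpret free: group "free_group B" by (rule group_free_group)
  define \<omega> where "\<omega> = inv_into (carrier (free_group B)) (word_value G)"
  have BG: "B \<subseteq> carrier G" and iso: "word_value G \<in> iso (free_group B) G"
    using B by (auto simp: free_basis_def)
  have "\<omega> \<in> iso G (free_group B)"
    using free.iso_set_sym[OF iso] by (simp add: \<omega>_def)
  then have mult: "\<omega> (g \<otimes> h) = \<omega> g \<star> \<omega> h" if "g \<in> carrier G" "h \<in> carrier G" for g h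
    using that by (auto simp: iso_def hom_def)
  have \<omega>_val: "\<omega> (word_value G w) = w" if "w \<in> carrier (free_group B)" for w
    using that iso by (auto simp: \<omega>_def iso_def bij_betw_def)
  have one: "\<omega> \<one> = []" using \<omega>_val[of "[]"] by simp
  have base: "\<omega> b = [(b, True)]" if "b \<in> B" for b
    using \<omega>_val[of "[(b, True)]"] that BG by (auto simp: letter_value_def reduced_Cons)
  let ?r = "\<lambda>T. {s \<in> S. parity T (\<omega> s)}"
  have "inj_on ?r (Pow B)"
  proof (rule inj_onI)
    fix T T' assume T: "T \<in> Pow B" "T' \<in> Pow B" "?r T = ?r T'"
    have "parity T (\<omega> g) = parity T' (\<omega> g)" if "g \<in> generate G S" for g
      using that
    proof induction
      case one
      then show ?case by (simp add: \<open>\<omega> \<one> = []\<close> parity_def)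
    next
      case (incl s)
      then show ?case using T(3) by blast
    next
      case (inv s)
      then have s: "s \<in> carrier G" using S by auto
      have "\<omega> s \<star> \<omega> (inv s) = []" using mult[of s "inv s"] s one by simp
      then have "parity U (\<omega> s) = parity U (\<omega> (inv s))" for U
        using parity_word_mult[of U "\<omega> s" "\<omega> (inv s)"] by (simp add: parity_def)
      then show ?case using T(3) inv by blast
    next
      case (eng g h)
      then have "g \<in> carrier G" "h \<in> carrier G" using S by auto
      then show ?case using eng by (simp add: mult parity_word_mult)
    qed
    then have "parity T (\<omega> b) = parity T' (\<omega> b)" if "b \<in> B" for b
      using that BG S(3) by auto
    moreover have "parity U (\<omega> b) \<longleftrightarrow> b \<in> U" if "b \<in> B" for b U
      by (simp add: base[OF that] parity_def)
    ultimately have "b \<in> T \<longleftrightarrow> b \<in> T'" if "b \<in> B" for b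
      using that by simp
    then show "T = T'" using T by blast
  qed
  moreover have "?r ` Pow B \<subseteq> Pow S" by blast
  ultimately have "card (Pow B) \<le> card (Pow S)" using S(1) by (intro card_inj_on_le) auto
  then show ?thesis using \<open>finite B\<close> S(1) by (simp add: card_Pow)
qed

lemma group_rank_le:
  "finite S \<Longrightarrow> S \<subseteq> carrier G \<Longrightarrow> generate G S = carrier G \<Longrightarrow> group_rank G \<le> card S"
  unfolding group_rank_def by (intro Least_le) blast

lemma group_rank_witness:
  assumes "finitely_generated G"
  obtains S where "finite S" "S \<subseteq> carrier G" "generate G S = carrier G" "card S = group_rank G"
proof -
  have "\<exists>k S. finite S \<and> S \<subseteq> carrier G \<and> generate G S = carrier G \<and> card S = k"
    using assms by (auto simp: finitely_generated_def)
  from LeastI_ex[OF this] show ?thesis using that unfolding group_rank_def by blast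
qed

lemma (in group) group_rank_eq_card_free_basis:
  assumes "free_basis G B" "finite B"
  shows "group_rank G = card B"
proof (rule antisym)
  have B: "B \<subseteq> carrier G" "generate G B = carrier G"
    using assms word_value_image[of B] by (auto simp: free_basis_def iso_def bij_betw_def)
  then show "group_rank G \<le> card B" using assms by (intro group_rank_le)
  have "finitely_generated G" using B assms by (auto simp: finitely_generated_def)
  then obtain S where "finite S" "S \<subseteq> carrier G" "generate G S = carrier G" "card S = group_rank G"
    by (rule group_rank_witness)
  then show "card B \<le> group_rank G" using free_basis_card_le[OF assms, of S] by simp
qed

section \<open>Nielsen reduced sets\<close>

definition with_inverses :: "'a word set \<Rightarrow> 'a word set" where
  "with_inverses B = B \<union> word_inv ` B"

text \<open>The classical conditions, expressed by the lengths of products of two elements so that they can be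
tested by evaluating such products. The first inequality says that at most half of a factor cancels
against a neighbour. In the second one, \<open>length x + length y - length (x \<star> y)\<close> is twice the number
of letters of \<open>y\<close> cancelled by \<open>x\<close>, and similarly for \<open>z\<close>; so it says that the two neighbours of
\<open>y\<close> together do not cancel all of \<open>y\<close>. That \<open>B\<close> is disjoint from its inverses excludes the empty
word and elements listed together with their inverses.\<close>

definition nielsen_reduced :: "'a word set \<Rightarrow> bool" where
  "nielsen_reduced B \<longleftrightarrow> B \<inter> word_inv ` B = {} \<and>
     (\<forall>x\<in>with_inverses B. \<forall>y\<in>with_inverses B. y \<noteq> word_inv x \<longrightarrow>
        length x \<le> length (x \<star> y) \<and>
        (\<forall>z\<in>with_inverses B. z \<noteq> word_inv y \<longrightarrow>
           length x + length z < length (x \<star> y) + length (y \<star> z)))"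

lemma with_inverses_word_inv [simp]: "word_inv x \<in> with_inverses B \<longleftrightarrow> x \<in> with_inverses B"
  by (force simp: with_inverses_def intro: image_eqI[where x = "word_inv x"])

lemma subset_with_inverses: "b \<in> B \<Longrightarrow> b \<in> with_inverses B"
  by (simp add: with_inverses_def)

lemma with_inversesE:
  assumes "x \<in> with_inverses B"
  obtains b where "b \<in> B" "x = b \<or> x = word_inv b"
  using assms by (auto simp: with_inverses_def)

lemma nielsen_reducedD:
  assumes "nielsen_reduced B" "x \<in> with_inverses B" "y \<in> with_inverses B" "y \<noteq> word_inv x"
  shows "length x \<le> length (x \<star> y)" "length y \<le> length (x \<star> y)"
    "z \<in> with_inverses B \<Longrightarrow> z \<noteq> word_inv y \<Longrightarrow>
      length x + length z < length (x \<star> y) + length (y \<star> z)"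
proof -
  have "word_inv x \<noteq> word_inv (word_inv y)" using assms(4) by auto
  then have "length (word_inv y) \<le> length (word_inv y \<star> word_inv x)"
    using assms(1-3) unfolding nielsen_reduced_def by (metis with_inverses_word_inv)
  then show "length y \<le> length (x \<star> y)" by (simp flip: word_inv_word_mult)
qed (use assms in \<open>auto simp: nielsen_reduced_def\<close>)

lemma nielsen_reduced_nonempty: "nielsen_reduced B \<Longrightarrow> x \<in> with_inverses B \<Longrightarrow> x \<noteq> []"
proof
  assume "nielsen_reduced B" "x \<in> with_inverses B" "x = []"
  then have "[] \<in> B" by (auto simp: with_inverses_def) (metis word_inv_Nil_iff)
  then have "[] \<in> B \<inter> word_inv ` B" by (auto intro!: image_eqI[of _ _ "[]"])
  then show False using \<open>nielsen_reduced B\<close> unfolding nielsen_reduced_def by blast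
qed

text \<open>The word \<open>t\<close> is what remains of the first factor \<open>u\<close> after the cancellation with the second one. A
further factor on the left cancels a proper prefix of \<open>t\<close>, because its two neighbours do not exhaust
\<open>u\<close>; hence the remainder \<open>s\<close> of the product is never touched again, and it grows by at least one letter
with each multiplication. Nor does a multiplication make the product shorter, since at most half of the new
factor cancels.\<close>

lemma nielsen_product:
  assumes B: "nielsen_reduced B" "\<forall>b\<in>B. reduced b"
    and us: "set (u # us) \<subseteq> with_inverses B" "successively (\<lambda>x y. y \<noteq> word_inv x) (u # us)"
  shows "\<exists>t s r. foldr (\<star>) (u # us) [] = t @ s \<and> u = t @ r \<and> t \<noteq> [] \<and>
    (if us = [] then t = u else 2 * length t + length (hd us) = length u + length (u \<star> hd us)) \<and>
    length us + length t \<le> length (t @ s) \<and> (\<forall>v\<in>set (u # us). length v \<le> length (t @ s))"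
  using us
proof (induction us arbitrary: u)
  case Nil
  moreover from this have "reduced u" using B(2) by (auto simp: with_inverses_def)
  moreover have "u \<noteq> []" using Nil B(1) nielsen_reduced_nonempty by auto
  ultimately show ?case by (intro exI[of _ u] exI[of _ "[]"]) simp
next
  case (Cons y us x)
  have xy: "x \<in> with_inverses B" "y \<in> with_inverses B" "y \<noteq> word_inv x" using Cons.prems by auto
  have red: "reduced x" "reduced y" using xy B(2) by (auto simp: with_inverses_def)
  obtain t s r where IH: "foldr (\<star>) (y # us) [] = t @ s" "y = t @ r" "t \<noteq> []"
    "if us = [] then t = y else 2 * length t + length (hd us) = length y + length (y \<star> hd us)"
    "length us + length t \<le> length (t @ s)" "\<forall>v\<in>set (y # us). length v \<le> length (t @ s)"
    using Cons.IH[of y] Cons.prems by auto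
  have ts: "reduced (t @ s)" using IH(1) reduced_word_mult[of y] by (metis comp_apply foldr.simps(2))
  obtain a p b where c: "x = a @ word_inv p" "y = p @ b" "x \<star> y = a @ b" "reduced (a @ b)"
    using cancellation[OF red] .
  have len: "length x = length a + length p" "length y = length p + length b"
    "length (x \<star> y) = length a + length b" using c by auto
  have half: "2 * length p \<le> length x" "2 * length p \<le> length y"
    using nielsen_reducedD(1,2)[OF B(1) xy] len by linarith+
  have nonempty: "x \<noteq> []" "y \<noteq> []" using xy B(1) nielsen_reduced_nonempty by blast+
  have "length p < length t"
  proof (cases us)
    case Nil
    then show ?thesis using IH(4) half len nonempty by (cases p) auto
  next
    case (Cons z us')
    then have "z \<in> with_inverses B" "z \<noteq> word_inv y" using Cons.prems by auto
    from nielsen_reducedD(3)[OF B(1) xy this] show ?thesis using IH(4) len Cons by simp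
  qed
  then obtain t' where t': "t = p @ t'" "t' \<noteq> []" "b = t' @ r"
    using IH(2) c(2) by (auto simp: append_eq_append_conv2)
  have "reduced (a @ t')" "reduced (t' @ s)"
    using c(4) ts t' by (simp_all add: reduced_append)
  then have "reduced (a @ t' @ s)" using t'(2) by (rule reduced_append_overlap)
  then have prod: "foldr (\<star>) (x # y # us) [] = a @ t' @ s"
    using IH(1) c(1) t'(1) reduce_cancel[of a p "t' @ s"] by (simp add: word_mult_def)
  have "a \<noteq> []" using half len nonempty by (cases p) auto
  moreover have "Suc (length us) \<le> length t' + length s" using IH(5) t' by (cases t') auto
  ultimately show ?case
    using IH(5,6) half len c(1) t'(1) prod
    by - (rule exI[of _ a], rule exI[of _ "t' @ s"], rule exI[of _ "word_inv p"], auto)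
qed

lemma letter_value_free_group:
  "fst a \<in> carrier (free_group X) \<Longrightarrow>
    letter_value (free_group X) a = (if snd a then fst a else word_inv (fst a))"
  using inv_free_group[of "fst a" X] by (simp add: letter_value_def)

text \<open>A reduced word over \<open>B\<close> is a sequence of factors from \<open>B\<close> and its inverses in which no factor is
followed by its own inverse.\<close>

lemma nielsen_word_value:
  assumes B: "nielsen_reduced B" "B \<subseteq> carrier (free_group X)" and w: "w \<in> carrier (free_group B)"
  defines "g \<equiv> word_value (free_group X) w"
  shows "length w \<le> length g" "\<And>a. a \<in> set w \<Longrightarrow> length (fst a) \<le> length g"
proof -
  interpret group "free_group X" by (rule group_free_group)
  let ?v = "letter_value (free_group X)"
  have v: "?v a = (if snd a then fst a else word_inv (fst a))" if "fst a \<in> B" for a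
    using that B(2) by (intro letter_value_free_group) auto
  have wB: "fst ` set w \<subseteq> B" "reduced w" using w by auto
  have sub: "set (map ?v w) \<subseteq> with_inverses B"
  proof
    fix x assume "x \<in> set (map ?v w)"
    then obtain a where "a \<in> set w" "x = ?v a" by auto
    moreover from this have "fst a \<in> B" using wB(1) by auto
    ultimately show "x \<in> with_inverses B" using v[of a] by (auto simp: with_inverses_def)
  qed
  have inj: "b = inv_letter a" if "fst a \<in> B" "fst b \<in> B" "?v b = word_inv (?v a)" for a b
  proof -
    have "(if snd b then fst b else word_inv (fst b))
        = word_inv (if snd a then fst a else word_inv (fst a))"
      using that(3) unfolding v[OF that(1)] v[OF that(2)] .
    moreover have "word_inv (fst a) \<notin> B" "word_inv (fst b) \<notin> B"
      using that(1,2) B(1) by (auto simp: nielsen_reduced_def)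
    ultimately show ?thesis using that(1,2)
      by (cases a; cases b) (auto simp: inv_letter_def split: if_splits)
  qed
  have "?v b \<noteq> word_inv (?v a)" if "a \<in> set w" "b \<in> set w" "b \<noteq> inv_letter a" for a b
    using inj[of a b] that wB(1) by blast
  then have succ: "successively (\<lambda>x y. y \<noteq> word_inv x) (map ?v w)"
    using wB(2) unfolding successively_map reduced_def by (elim successively_mono)
  have g: "g = foldr (\<star>) (map ?v w) []"
    unfolding g_def by (induction w) simp_all
  have "length w \<le> length g \<and> (\<forall>v\<in>set (map ?v w). length v \<le> length g)"
  proof (cases w)
    case (Cons a w')
    have "\<forall>b\<in>B. reduced b" using B(2) by auto
    with sub succ obtain t s where "g = t @ s" "t \<noteq> []" "length w' + length t \<le> length (t @ s)"
      "\<forall>v\<in>set (map ?v w). length v \<le> length (t @ s)"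
      using nielsen_product[OF B(1), of "?v a" "map ?v w'"] g Cons by auto
    then show ?thesis using Cons by (cases t) auto
  qed simp
  moreover have "length (?v a) = length (fst a)" if "a \<in> set w" for a
    using v[of a] wB(1) that by auto
  ultimately show "length w \<le> length g" "\<And>a. a \<in> set w \<Longrightarrow> length (fst a) \<le> length g"
    by auto
qed

lemma (in group) word_value_subgroup:
  assumes "subgroup K G" "fst ` set w \<subseteq> K"
  shows "word_value (G\<lparr>carrier := K\<rparr>) w = word_value G w"
  using assms(2)
proof (induction w)
  case (Cons a w)
  interpret K: group "G\<lparr>carrier := K\<rparr>" using assms(1) by (rule subgroup_imp_group)
  show ?case using Cons by (auto simp: letter_value_def m_inv_consistent[OF assms(1)])
qed (simp add: word_value_def)

text \<open>The length of the value of a word bounds the length of the word, so only the empty word has the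
trivial value.\<close>

lemma nielsen_free_basis:
  assumes B: "nielsen_reduced B" "B \<subseteq> carrier (free_group X)"
  shows "free_basis (free_group X\<lparr>carrier := generate (free_group X) B\<rparr>) B"
proof -
  interpret group "free_group X" by (rule group_free_group)
  let ?K = "generate (free_group X) B"
  have K: "subgroup ?K (free_group X)" using B(2) by (rule generate_is_subgroup)
  interpret K: group "free_group X\<lparr>carrier := ?K\<rparr>" using K by (rule subgroup_imp_group)
  interpret free: group "free_group B" by (rule group_free_group)
  let ?v = "word_value (free_group X\<lparr>carrier := ?K\<rparr>)"
  have BK: "B \<subseteq> ?K" by (blast intro: generate.incl)
  then have hom: "?v \<in> hom (free_group B) (free_group X\<lparr>carrier := ?K\<rparr>)"
    by (intro K.word_value_hom) simp
  then interpret h: group_hom "free_group B" "free_group X\<lparr>carrier := ?K\<rparr>" ?v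
    by unfold_locales
  have "?v ` carrier (free_group B) = ?K"
    using K.word_value_image[of B] BK generate_consistent[OF BK K] by simp
  moreover have "w = []" if "w \<in> carrier (free_group B)" "?v w = []" for w
  proof -
    have "word_value (free_group X) w = []"
      using word_value_subgroup[OF K, of w] that BK by auto
    then show ?thesis using nielsen_word_value(1)[OF B that(1)] by simp
  qed
  then have "inj_on ?v (carrier (free_group B))"
    unfolding h.inj_on_one_iff by simp
  ultimately show ?thesis
    using hom BK by (simp add: free_basis_def iso_def bij_betw_def)
qed

section \<open>Existence of Nielsen reduced generating sets\<close>

text \<open>The lexicographic order on words of equal length, as the order of numbers written in base \<open>M\<close>.\<close>

definition lex_value :: "('a \<Rightarrow> nat) \<Rightarrow> nat \<Rightarrow> 'a list \<Rightarrow> nat" where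
  "lex_value d M w = foldl (\<lambda>n a. n * M + d a) 0 w"

lemma lex_value_append: "lex_value d M (u @ v) = lex_value d M u * M ^ length v + lex_value d M v"
proof (induction v rule: rev_induct)
  case (snoc a v)
  have "lex_value d M (x @ [a]) = lex_value d M x * M + d a" for x by (simp add: lex_value_def)
  from this[of "u @ v"] this[of v] snoc show ?case by (simp add: algebra_simps)
qed (simp add: lex_value_def)

lemma lex_value_inj:
  assumes "inj_on d A" "d ` A \<subseteq> {..<M}" "length u = length v" "set u \<subseteq> A" "set v \<subseteq> A"
    "lex_value d M u = lex_value d M v"
  shows "u = v"
  using assms(3-)
proof (induction u arbitrary: v rule: rev_induct)
  case (snoc a u)
  then obtain v' b where v: "v = v' @ [b]" by (cases v rule: rev_cases) auto
  have "lex_value d M u * M + d a = lex_value d M v' * M + d b"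
    using snoc.prems by (simp add: v lex_value_def)
  moreover have "d a < M" "d b < M" using snoc.prems assms(2) by (auto simp: v)
  ultimately have "lex_value d M u = lex_value d M v'" "d a = d b"
    by (metis div_mult_self3 div_less add.right_neutral add_0 less_nat_zero_code,
        metis mod_mult_self3 mod_less)
  then show ?case using snoc assms(1) by (auto simp: v dest: inj_onD)
qed simp

text \<open>Nielsen's order compares words by their initial halves and those of their inverses. Here it is a
numerical weight that does not distinguish a word from its inverse, so that weights can be added up
over a generating set. Exchanging a prefix of at most half the length for a lexicographically
smaller one of the same length decreases it, since the other half is unaffected.\<close>

definition half_weight :: "('a letter \<Rightarrow> nat) \<Rightarrow> nat \<Rightarrow> 'a word \<Rightarrow> nat" where
  "half_weight d M w = (let h = (length w + 1) div 2 in
     lex_value d M (take h w) + lex_value d M (take h (word_inv w)))"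

lemma half_weight_word_inv [simp]: "half_weight d M (word_inv w) = half_weight d M w"
  by (simp add: half_weight_def Let_def add.commute)

lemma half_weight_prefix:
  assumes "length p = length q" "length q \<le> length c" "0 < M"
    "half_weight d M (q @ c) \<le> half_weight d M (p @ c)"
  shows "lex_value d M q \<le> lex_value d M p"
proof -
  define h where "h = Suc (length q + length c) div 2"
  have h: "length q \<le> h" "h \<le> length c" using assms(2) by (auto simp: h_def)
  have "half_weight d M (x @ c) = lex_value d M x * M ^ (h - length q)
      + lex_value d M (take (h - length q) c) + lex_value d M (take h (word_inv c))"
    if "length x = length q" for x
    using that h by (simp add: half_weight_def Let_def lex_value_append h_def[symmetric])
      (simp add: lex_value_def)
  from this[of q] this[of p] assms show ?thesis by simp
qed

text \<open>Among the generating sets of least cardinality, choose one of least total length and, among these,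
of least total weight. Replacing an element \<open>x\<close> by \<open>x \<star> y\<close> gives another generating set, so it
never leads to a shorter word, nor to a word of equal length and smaller weight. The former is the
first Nielsen condition. If the second one fails for \<open>x\<close>, \<open>y\<close>, \<open>z\<close>, then \<open>y\<close> consists of a half \<open>p\<close>
cancelled by \<open>x\<close> and the inverse of a half \<open>q\<close> cancelled by \<open>z\<close>; multiplication by \<open>y\<close> exchanges \<open>p\<close>
and \<open>q\<close> in \<open>x\<close> and in \<open>z\<close> in opposite directions. As neither exchange lowers the weight, \<open>p = q\<close>, and
\<open>y\<close> would be trivial.\<close>

lemma nielsen_generators_exist:
  assumes "finite X" and K: "subgroup K (free_group X)"
    and fg: "finitely_generated (free_group X\<lparr>carrier := K\<rparr>)"
  obtains B where "finite B" "B \<subseteq> carrier (free_group X)" "generate (free_group X) B = K"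
    "card B = group_rank (free_group X\<lparr>carrier := K\<rparr>)" "nielsen_reduced B"
proof -
  let ?G = "free_group X"
  interpret group ?G by (rule group_free_group)
  define k where "k = group_rank (?G\<lparr>carrier := K\<rparr>)"
  have KG: "K \<subseteq> carrier ?G" using K by (rule subgroup.subset)
  have k_le: "k \<le> card S" if "finite S" "S \<subseteq> carrier ?G" "generate ?G S = K" for S
  proof -
    have "S \<subseteq> K" using that(3) by (blast intro: generate.incl)
    then show ?thesis
      unfolding k_def using that generate_consistent[OF _ K, of S] by (intro group_rank_le) auto
  qed
  obtain d :: "'a letter \<Rightarrow> nat" and M where d: "inj_on d (X \<times> UNIV)" "d ` (X \<times> UNIV) \<subseteq> {..<M}"
  proof -
    have "finite (X \<times> (UNIV :: bool set))" using \<open>finite X\<close> by simp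
    then obtain d :: "'a letter \<Rightarrow> nat" and M where "d ` (X \<times> UNIV) = {i. i < M}" "inj_on d (X \<times> UNIV)"
      using finite_imp_inj_to_nat_seg by metis
    then show ?thesis using that by (metis lessThan_def order_refl)
  qed
  define \<phi> where "\<phi> = half_weight d M"
  define generators where
    "generators = {B. finite B \<and> B \<subseteq> carrier ?G \<and> generate ?G B = K \<and> card B = k}"
  define m where "m = (\<lambda>B. (\<Sum>b\<in>B. length b, \<Sum>b\<in>B. \<phi> b))"
  obtain S where S: "finite S" "S \<subseteq> K" "generate (?G\<lparr>carrier := K\<rparr>) S = K" "card S = k"
    using group_rank_witness[OF fg] by (auto simp: k_def)
  then have "S \<in> generators"
    using generate_consistent[OF S(2) K] KG by (auto simp: generators_def)
  moreover have "wf (inv_image (less_than <*lex*> less_than) m)" by auto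
  ultimately obtain B where B: "B \<in> generators"
    and minimal: "\<And>B'. (m B', m B) \<in> less_than <*lex*> less_than \<Longrightarrow> B' \<notin> generators"
    by (elim wfE_min) (auto simp: in_inv_image)
  have B': "finite B" "B \<subseteq> carrier ?G" "generate ?G B = K" "card B = k"
    using B by (auto simp: generators_def)
  have reds: "reduced x" "x \<in> carrier ?G" if x: "x \<in> with_inverses B" for x
  proof -
    obtain b where b: "b \<in> B" "x = b \<or> x = word_inv b" using x by (rule with_inversesE)
    then have "b \<in> carrier ?G" using B'(2) by blast
    then show "x \<in> carrier ?G" using b(2) by (elim disjE) simp_all
    then show "reduced x" by simp
  qed
  have in_gen: "x \<in> generate ?G S" if "x \<in> with_inverses S" "S \<subseteq> carrier ?G" for x S
  proof -
    obtain b where b: "b \<in> S" "x = b \<or> x = word_inv b" using \<open>x \<in> with_inverses S\<close> by (rule with_inversesE)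
    then have "inv\<^bsub>?G\<^esub> b = word_inv b" using that(2) by (intro inv_free_group) auto
    then show ?thesis using b generate.incl[of b S ?G] generate.inv[of b S ?G] by auto
  qed
  have irredundant: "b \<notin> generate ?G (B - {b})" if "b \<in> B" for b
  proof
    assume b: "b \<in> generate ?G (B - {b})"
    have sub: "subgroup (generate ?G (B - {b})) ?G"
      using B'(2) by (intro generate_is_subgroup) auto
    have "B \<subseteq> generate ?G (B - {b})" using b by (auto intro: generate.incl)
    then have "K \<subseteq> generate ?G (B - {b})"
      unfolding B'(3)[symmetric] using sub by (rule generate_subgroup_incl)
    moreover have "generate ?G (B - {b}) \<subseteq> K"
      unfolding B'(3)[symmetric] by (rule mono_generate) auto
    ultimately have "k \<le> card (B - {b})" using B' by (intro k_le) auto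
    then show False using that B' card_gt_0_iff[of B] by (auto simp: card_Diff_singleton)
  qed
  have exchange: "length x < length (x \<star> y) \<or> length x = length (x \<star> y) \<and> \<phi> x \<le> \<phi> (x \<star> y)"
    if xy: "x \<in> with_inverses B" "y \<in> with_inverses B" "y \<noteq> x" "y \<noteq> word_inv x" for x y
  proof (rule ccontr)
    assume less: "\<not> ?thesis"
    obtain b where b: "b \<in> B" "x = b \<or> x = word_inv b" using xy(1) by (rule with_inversesE)
    obtain c where c: "c \<in> B" "y = c \<or> y = word_inv c" using xy(2) by (rule with_inversesE)
    have "c \<noteq> b" using b c xy(3,4) by auto
    define B0 where "B0 = B - {b}"
    define B1 where "B1 = insert (x \<star> y) B0"
    have xG: "x \<in> carrier ?G" "y \<in> carrier ?G" using xy reds by auto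
    then have xyG: "x \<star> y \<in> carrier ?G" using m_closed[of x y] by simp
    have B1G: "B1 \<subseteq> carrier ?G" unfolding B1_def B0_def using xyG B'(2) by blast
    have "x \<star> y \<in> K"
      using generate.eng[OF in_gen[OF xy(1) B'(2)] in_gen[OF xy(2) B'(2)]] B'(3) by simp
    then have "B1 \<subseteq> K" using B'(3) by (auto simp: B1_def B0_def intro: generate.incl)
    then have "generate ?G B1 \<subseteq> K" using K by (rule generate_subgroup_incl)
    moreover have "K \<subseteq> generate ?G B1"
    proof -
      have sub: "subgroup (generate ?G B1) ?G" using B1G by (rule generate_is_subgroup)
      have "c \<in> B1" using c \<open>c \<noteq> b\<close> by (simp add: B1_def B0_def)
      then have "word_inv y \<in> generate ?G B1"
        using c B1G by (intro in_gen) (auto simp: with_inverses_def)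
      moreover have "x \<star> y \<in> generate ?G B1" by (intro generate.incl) (simp add: B1_def)
      ultimately have "(x \<star> y) \<star> word_inv y \<in> generate ?G B1"
        using generate.eng[of "x \<star> y" ?G B1 "word_inv y"] by simp
      then have x: "x \<in> generate ?G B1" using xG by (simp add: word_mult_assoc)
      then have "inv\<^bsub>?G\<^esub> x \<in> generate ?G B1" using sub by (rule subgroup.m_inv_closed[rotated])
      then have "b \<in> generate ?G B1" using x b(2) xG inv_free_group[of x X] by auto
      then have "B \<subseteq> generate ?G B1" by (auto simp: B1_def B0_def intro: generate.incl)
      then show ?thesis unfolding B'(3)[symmetric] using sub by (rule generate_subgroup_incl)
    qed
    ultimately have gen: "generate ?G B1 = K" by blast
    have fin: "finite B0" using B'(1) by (simp add: B0_def)
    have card0: "Suc (card B0) = k"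
      using B' b(1) card_Suc_Diff1[of B b] by (simp add: B0_def)
    \<comment> \<open>If the new element were already present, \<open>B1\<close> would be too small to generate.\<close>
    have "k \<le> card B1" using fin B1G gen by (intro k_le) (auto simp: B1_def)
    then have new: "x \<star> y \<notin> B0" using card0 fin by (auto simp: B1_def insert_absorb)
    then have "B1 \<in> generators"
      using card0 fin B1G gen by (auto simp: generators_def B1_def)
    moreover have "(\<Sum>b\<in>B1. f b) = f (x \<star> y) + (\<Sum>b\<in>B0. f b)" for f :: "'a word \<Rightarrow> nat"
      using new fin by (simp add: B1_def)
    moreover have "(\<Sum>b\<in>B. f b) = f b + (\<Sum>b\<in>B0. f b)" for f :: "'a word \<Rightarrow> nat"
      using b(1) B'(1) by (simp add: B0_def sum.remove)
    moreover have "length b = length x" "\<phi> b = \<phi> x" using b(2) by (auto simp: \<phi>_def)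
    moreover have "length (x \<star> y) < length x \<or> length (x \<star> y) = length x \<and> \<phi> (x \<star> y) < \<phi> x"
      using less by linarith
    ultimately show False using minimal[of B1] by (auto simp: m_def)
  qed
  have "B \<inter> word_inv ` B = {}"
  proof (rule ccontr)
    assume "B \<inter> word_inv ` B \<noteq> {}"
    then obtain b where b: "b \<in> B" "word_inv b \<in> B" by auto
    have "b \<in> generate ?G (B - {b})"
    proof (cases "b = []")
      case True
      then show ?thesis using generate.one[of ?G "B - {b}"] by simp
    next
      case False
      then have "word_inv b \<in> B - {b}" using b word_inv_neq[of b] B'(2) by auto
      then show ?thesis using B'(2)
        by (intro in_gen) (auto simp: with_inverses_def intro!: image_eqI[of _ _ "word_inv b"])
    qed
    then show False using irredundant b by blast
  qed
  moreover have N1: "length x \<le> length (x \<star> y)"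
    if "x \<in> with_inverses B" "y \<in> with_inverses B" "y \<noteq> word_inv x" for x y
    using that exchange[of x y] length_word_mult_self[of x] reds[of x] by (cases "y = x") auto
  moreover have "length x + length z < length (x \<star> y) + length (y \<star> z)"
    if xyz: "x \<in> with_inverses B" "y \<in> with_inverses B" "z \<in> with_inverses B"
      "y \<noteq> word_inv x" "z \<noteq> word_inv y" for x y z
  proof -
    have red: "reduced x" "reduced y" "reduced z" using xyz reds by auto
    obtain a p b where c: "x = a @ word_inv p" "y = p @ b" "x \<star> y = a @ b"
      using cancellation[OF red(1,2)] .
    obtain a' q e where c': "y = a' @ word_inv q" "z = q @ e" "y \<star> z = a' @ e"
      using cancellation[OF red(2,3)] .
    have len: "length x = length a + length p" "length y = length p + length b"
      "length (x \<star> y) = length a + length b" "length y = length a' + length q"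
      "length z = length q + length e" "length (y \<star> z) = length a' + length e"
      using c[THEN arg_cong[where f = length]] c'[THEN arg_cong[where f = length]] by simp_all
    have "length y \<le> length (x \<star> y)"
      using N1[of "word_inv y" "word_inv x"] xyz by (auto simp flip: word_inv_word_mult)
    moreover have "length z \<le> length (y \<star> z)"
      using N1[of "word_inv z" "word_inv y"] xyz by (auto simp flip: word_inv_word_mult)
    moreover have "length x \<le> length (x \<star> y)" "length y \<le> length (y \<star> z)"
      using N1 xyz by auto
    ultimately have half: "2 * length p \<le> length x" "2 * length p \<le> length y"
      "2 * length q \<le> length y" "2 * length q \<le> length z" using len by linarith+
    show ?thesis
    proof (rule ccontr)
      assume "\<not> ?thesis"
      \<comment> \<open>The cancelled parts of \<open>y\<close> are at most halves and together exhaust it, so both are halves.\<close>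
      then have eq: "length p = length q" "length y = 2 * length p" using half len by linarith+
      then have y: "y = p @ word_inv q" "a' = p" "b = word_inv q"
        using c c' len by (auto simp: append_eq_append_conv)
      have "x \<star> y = a @ word_inv q" "y \<star> z = p @ e" using c c' y by auto
      have lz: "length (y \<star> z) = length z" using len eq y(2) by simp
      have "y \<noteq> []"
      proof
        assume "y = []"
        then have "[] \<in> B"
          using xyz(2) by (auto simp: with_inverses_def) (metis word_inv_Nil_iff)
        then show False using irredundant[of "[]"] generate.one[of ?G "B - {[]}"] by simp
      qed
      have "y \<noteq> x"
        using cancel_self_less_half[OF red(2), of p b a] c eq \<open>y \<noteq> []\<close> by auto
      then have "\<phi> x \<le> \<phi> (x \<star> y)" using exchange[of x y] xyz len y eq by auto
      moreover have "word_inv y \<noteq> word_inv z"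
        using cancel_self_less_half[OF red(2), of q e a'] c' eq \<open>y \<noteq> []\<close> by auto
      then have "\<phi> (word_inv z) \<le> \<phi> (word_inv (y \<star> z))"
        using exchange[of "word_inv z" "word_inv y", folded word_inv_word_mult] xyz lz by auto
      moreover have "\<phi> x = half_weight d M (p @ word_inv a)"
        unfolding \<phi>_def c(1) by (subst half_weight_word_inv[symmetric]) simp
      moreover have "\<phi> (x \<star> y) = half_weight d M (q @ word_inv a)"
        unfolding \<phi>_def \<open>x \<star> y = a @ word_inv q\<close> by (subst half_weight_word_inv[symmetric]) simp
      moreover have "\<phi> (word_inv z) = half_weight d M (q @ e)"
        by (simp add: \<phi>_def c'(2) del: word_inv_simps(2))
      moreover have "\<phi> (word_inv (y \<star> z)) = half_weight d M (p @ e)"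
        by (simp add: \<phi>_def \<open>y \<star> z = p @ e\<close> del: word_inv_simps(2))
      ultimately have le: "half_weight d M (p @ word_inv a) \<le> half_weight d M (q @ word_inv a)"
        "half_weight d M (q @ e) \<le> half_weight d M (p @ e)" by simp_all
      have letters: "set p \<subseteq> X \<times> UNIV" "set (word_inv q) \<subseteq> X \<times> UNIV"
        using reds(2)[OF xyz(2)] y by auto
      then have "fst ` set (word_inv q) \<subseteq> fst ` (X \<times> (UNIV :: bool set))" by (intro image_mono)
      then have lettersq: "set q \<subseteq> X \<times> UNIV" unfolding letters_word_inv by force
      have "p \<noteq> []" using \<open>y \<noteq> []\<close> eq by auto
      then have "d (hd p) < M" using d(2) letters(1) hd_in_set[of p] by blast
      then have "0 < M" by simp
      then have "lex_value d M p = lex_value d M q"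
        using half_weight_prefix[of p q e M d] half_weight_prefix[of q p "word_inv a" M d] le eq half len
        by simp
      then have "p = q" using lex_value_inj[OF d eq(1) letters(1) lettersq] by simp
      then show False
        using cancel_self_less_half[OF red(2), of p b p] y(1) c(2) eq \<open>y \<noteq> []\<close> by auto
    qed
  qed
  ultimately have "nielsen_reduced B" by (auto simp: nielsen_reduced_def)
  then show ?thesis using that B' by (simp add: k_def)
qed

section \<open>Subgroups of minimal rank\<close>

lemma (in group) subgroup_rank_le:
  assumes "finite S" "S \<subseteq> carrier G"
  shows "group_rank (G\<lparr>carrier := generate G S\<rparr>) \<le> card S"
proof (rule group_rank_le)
  have S: "S \<subseteq> generate G S" by (blast intro: generate.incl)
  then show "S \<subseteq> carrier (G\<lparr>carrier := generate G S\<rparr>)" by simp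
  show "generate (G\<lparr>carrier := generate G S\<rparr>) S = carrier (G\<lparr>carrier := generate G S\<rparr>)"
    using generate_consistent[OF S generate_is_subgroup[OF assms(2)]] by simp
qed (rule assms)

lemma (in group) generate_in_fg_overgroups:
  assumes "finite S" "S \<subseteq> carrier G" "H \<subseteq> generate G S"
  shows "generate G S \<in> fg_overgroups G H"
proof -
  have S: "S \<subseteq> generate G S" by (blast intro: generate.incl)
  have "subgroup (generate G S) G" using assms(2) by (rule generate_is_subgroup)
  moreover from this have "finitely_generated (G\<lparr>carrier := generate G S\<rparr>)"
    unfolding finitely_generated_def
    using S assms(1) generate_consistent[OF S] by (intro exI[of _ S]) simp
  ultimately show ?thesis using assms(3) by (simp add: fg_overgroups_def)
qed

lemma nielsen_rank:
  assumes "nielsen_reduced B" "B \<subseteq> carrier (free_group X)" "finite B"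
  shows "group_rank (free_group X\<lparr>carrier := generate (free_group X) B\<rparr>) = card B"
proof -
  interpret group "free_group X" by (rule group_free_group)
  interpret K: group "free_group X\<lparr>carrier := generate (free_group X) B\<rparr>"
    using assms(2) by (intro subgroup_imp_group generate_is_subgroup)
  show ?thesis using nielsen_free_basis[OF assms(1,2)] assms(3) by (rule K.group_rank_eq_card_free_basis)
qed

text \<open>The element \<open>b\<close> occurs in the expression of some element of \<open>S\<close>, and no factor of a product is longer
than the product.\<close>

lemma nielsen_irredundant_length:
  assumes B: "nielsen_reduced B" "B \<subseteq> carrier (free_group X)"
    and S: "S \<subseteq> generate (free_group X) B" "\<not> S \<subseteq> generate (free_group X) (B - {b})"
  shows "\<exists>s\<in>S. length b \<le> length s"
proof -
  interpret group "free_group X" by (rule group_free_group)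
  obtain s where s: "s \<in> S" "s \<notin> generate (free_group X) (B - {b})" using S(2) by blast
  then obtain w where w: "w \<in> carrier (free_group B)" "s = word_value (free_group X) w"
    using S(1) word_value_image[OF B(2)] by blast
  have "b \<in> fst ` set w"
  proof (rule ccontr)
    assume "b \<notin> fst ` set w"
    then have "w \<in> carrier (free_group (B - {b}))" using w(1) by auto
    then have "s \<in> generate (free_group X) (B - {b})"
      using word_value_image[of "B - {b}"] B(2) w(2) by blast
    then show False using s(2) by simp
  qed
  then show ?thesis using nielsen_word_value(2)[OF B w(1)] w(2) s(1) by auto
qed

text \<open>An overgroup generated by at most one element is abelian, whereas two different elements of a basis
of \<open>H\<close> have a nontrivial commutator.\<close>

lemma reduced_rank_overgroup:
  assumes "finite X" and H: "subgroup H (free_group X)" "finitely_generated (free_group X\<lparr>carrier := H\<rparr>)"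
    and K: "K \<in> fg_overgroups (free_group X) H"
    and zero: "reduced_rank (free_group X\<lparr>carrier := K\<rparr>) = 0"
  shows "reduced_rank (free_group X\<lparr>carrier := H\<rparr>) = 0"
proof (rule ccontr)
  let ?G = "free_group X"
  interpret group ?G by (rule group_free_group)
  assume "reduced_rank (?G\<lparr>carrier := H\<rparr>) \<noteq> 0"
  obtain B where B: "finite B" "B \<subseteq> carrier ?G" "generate ?G B = H"
    "card B = group_rank (?G\<lparr>carrier := H\<rparr>)" "nielsen_reduced B"
    using nielsen_generators_exist[OF assms(1) H] .
  then have "2 \<le> card B"
    using \<open>reduced_rank (?G\<lparr>carrier := H\<rparr>) \<noteq> 0\<close> by (simp add: reduced_rank_def)
  then obtain x y where xy: "x \<in> B" "y \<in> B" "x \<noteq> y"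
    by (metis card_le_Suc0_iff_eq B(1) not_less_eq_eq numeral_2_eq_2)
  have K': "subgroup K ?G" "finitely_generated (?G\<lparr>carrier := K\<rparr>)" "H \<subseteq> K"
    using K by (simp_all add: fg_overgroups_def)
  obtain C where C: "finite C" "C \<subseteq> carrier ?G" "generate ?G C = K"
    "card C = group_rank (?G\<lparr>carrier := K\<rparr>)"
    using nielsen_generators_exist[OF assms(1) K'(1,2)] .
  then have "card C \<le> Suc 0" using zero by (simp add: reduced_rank_def)
  then have eq: "u = v" if "u \<in> C" "v \<in> C" for u v
    using that C(1) by (simp add: card_le_Suc0_iff_eq)
  obtain c where c: "c \<in> carrier ?G" "C \<subseteq> {c}"
  proof (cases "C = {}")
    case True
    then show ?thesis using that[of "\<one>\<^bsub>?G\<^esub>"] one_closed by blast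
  next
    case False
    then obtain c where "c \<in> C" by blast
    then show ?thesis using that[of c] C(2) eq by blast
  qed
  have "x \<in> generate ?G {c}" "y \<in> generate ?G {c}"
    using generate.incl[OF xy(1), of ?G] generate.incl[OF xy(2), of ?G] B(3) C(3) K'(3)
      mono_generate[OF c(2)] by blast+
  then obtain i j :: int where ij: "x = c [^]\<^bsub>?G\<^esub> i" "y = c [^]\<^bsub>?G\<^esub> j"
    using generate_pow[OF c(1)] by auto
  then have comm: "x \<otimes>\<^bsub>?G\<^esub> y = y \<otimes>\<^bsub>?G\<^esub> x"
    using c(1) by (simp only: int_pow_mult[symmetric] add.commute)
  have xyG: "x \<in> carrier ?G" "y \<in> carrier ?G" using xy B(2) by auto
  \<comment> \<open>The commutator of \<open>x\<close> and \<open>y\<close>, as a reduced word over the basis.\<close>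
  let ?w = "[(x, True), (y, True), (x, False), (y, False)]"
  have "word_value ?G ?w = x \<otimes>\<^bsub>?G\<^esub> (y \<otimes>\<^bsub>?G\<^esub> (inv\<^bsub>?G\<^esub> x \<otimes>\<^bsub>?G\<^esub> inv\<^bsub>?G\<^esub> y))"
    using xyG by (simp add: letter_value_def del: free_group_simps)
  also have "\<dots> = (x \<otimes>\<^bsub>?G\<^esub> y) \<otimes>\<^bsub>?G\<^esub> inv\<^bsub>?G\<^esub> (y \<otimes>\<^bsub>?G\<^esub> x)"
    using xyG by (simp add: inv_mult_group m_assoc del: free_group_simps)
  also have "\<dots> = \<one>\<^bsub>?G\<^esub>" using xyG by (simp only: comm) (rule r_inv, rule m_closed)
  finally have "word_value ?G ?w = []" by simp
  moreover have "?w \<in> carrier (free_group B)"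
    using xy by (auto simp: reduced_Cons inv_letter_def)
  ultimately show False using nielsen_word_value(1)[OF B(5,2), of ?w] by simp
qed

text \<open>The numerator does not depend on the overgroup, so the ratio is largest where the denominator is
smallest. If that denominator vanishes, so does the numerator, and all ratios are at most 1, which
is the value of the ratio at \<open>K\<close> by the convention for \<open>0 / 0\<close>.\<close>

lemma dc_eq_ratio_of_minimal_rank:
  assumes "finite X" and H: "subgroup H (free_group X)" "finitely_generated (free_group X\<lparr>carrier := H\<rparr>)"
    and K: "K \<in> fg_overgroups (free_group X) H"
    and minimal: "\<And>K'. K' \<in> fg_overgroups (free_group X) H \<Longrightarrow>
      group_rank (free_group X\<lparr>carrier := K\<rparr>) \<le> group_rank (free_group X\<lparr>carrier := K'\<rparr>)"
  defines "r \<equiv> \<lambda>K. reduced_rank (free_group X\<lparr>carrier := K\<rparr>)"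
  shows "dc (free_group X) H = compression_ratio (free_group X) H K"
    and "compression_ratio (free_group X) H K = ereal (if r K = 0 then 1 else real (r H) / real (r K))"
proof -
  let ?G = "free_group X"
  have ratio: "compression_ratio ?G H L = ereal (if r L = 0 then 1 else real (r H) / real (r L))"
    if "L \<in> fg_overgroups ?G H" for L
    using reduced_rank_overgroup[OF assms(1) H that]
    by (auto simp: compression_ratio_def Let_def r_def)
  have le: "r K \<le> r L" if "L \<in> fg_overgroups ?G H" for L
    using minimal[OF that] by (simp add: r_def reduced_rank_def)
  have zero: "r H = 0" if "r K = 0"
    using reduced_rank_overgroup[OF assms(1) H K] that by (simp add: r_def)
  show "compression_ratio ?G H K = ereal (if r K = 0 then 1 else real (r H) / real (r K))"
    using ratio[OF K] .
  have "compression_ratio ?G H L \<le> compression_ratio ?G H K" if "L \<in> fg_overgroups ?G H" for L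
    unfolding ratio[OF K] ratio[OF that] using le[OF that] zero
    by (auto intro!: divide_left_mono)
  then show "dc ?G H = compression_ratio ?G H K"
    unfolding dc_def using K by (intro antisym SUP_least SUP_upper)
qed

section \<open>Finding an overgroup of minimal rank, and the rank of a subgroup\<close>

definition signed :: "'a word list \<Rightarrow> 'a word list" where
  "signed B = B @ map word_inv B"

primrec products :: "'a word list \<Rightarrow> nat \<Rightarrow> 'a word list" where
  "products B 0 = [[]]"
| "products B (Suc N) = products B N @ concat (map (\<lambda>u. map (word_mult u) (products B N)) (signed B))"

definition alphabet :: "nat \<Rightarrow> nat word list" where
  "alphabet n = map (\<lambda>i. [(i, True)]) [1..<Suc n]"

text \<open>The total length \<open>L\<close> of the generators serves as a bound twice: for the words allowed in a basis, and
for the number of factors that are needed to express a generator in a Nielsen reduced set.\<close>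

definition candidates :: "nat \<Rightarrow> nat word list \<Rightarrow> nat word list list" where
  "candidates n hs =
    (let L = length (concat hs) in
      filter (\<lambda>B. nielsen_reduced (set B) \<and> (\<forall>h\<in>set hs. h \<in> set (products B L)))
        (subseqs (remdups (products (alphabet n) L))))"

definition shortest :: "'a list list \<Rightarrow> 'a list" where
  "shortest cs = (case cs of [] \<Rightarrow> []
    | c # cs' \<Rightarrow> foldr (\<lambda>B A. if length B \<le> length A then B else A) cs' c)"

definition spans_within :: "nat word list \<Rightarrow> nat \<Rightarrow> nat word list \<Rightarrow> bool" where
  "spans_within hs N B \<longleftrightarrow> (\<forall>b\<in>set B. b \<in> set (products hs N))"

lemma set_signed: "set (signed B) = with_inverses (set B)"
  by (simp add: signed_def with_inverses_def)

lemma shortest_in: "cs \<noteq> [] \<Longrightarrow> shortest cs \<in> set cs"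
  and length_shortest: "B \<in> set cs \<Longrightarrow> length (shortest cs) \<le> length B"
proof -
  have *: "foldr (\<lambda>B A. if length B \<le> length A then B else A) cs c \<in> set (c # cs) \<and>
    (\<forall>B\<in>set (c # cs). length (foldr (\<lambda>B A. if length B \<le> length A then B else A) cs c) \<le> length B)"
    for c :: "'a list" and cs by (induction cs) auto
  show "cs \<noteq> [] \<Longrightarrow> shortest cs \<in> set cs"
    using * by (cases cs) (auto simp: shortest_def split: list.split)
  show "B \<in> set cs \<Longrightarrow> length (shortest cs) \<le> length B"
    using * by (cases cs) (auto simp: shortest_def split: list.split)
qed

lemma products_mono: "set (products B N) \<subseteq> set (products B (N + k))"
  by (induction k) auto

lemma products_subset_generate:
  assumes "set B \<subseteq> carrier (free_group X)"
  shows "set (products B N) \<subseteq> generate (free_group X) (set B)"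
proof (induction N)
  case 0
  then show ?case using generate.one[of "free_group X" "set B"] by simp
next
  case (Suc N)
  have "u \<star> v \<in> generate (free_group X) (set B)"
    if uv: "u \<in> set (signed B)" "v \<in> set (products B N)" for u v
  proof -
    have "u \<in> with_inverses (set B)" using uv(1) by (simp add: set_signed)
    then obtain b where b: "b \<in> set B" "u = b \<or> u = word_inv b" by (rule with_inversesE)
    then have "inv\<^bsub>free_group X\<^esub> b = word_inv b" using assms by (intro inv_free_group) auto
    then have "u \<in> generate (free_group X) (set B)"
      using b generate.incl[of b "set B" "free_group X"] generate.inv[of b "set B" "free_group X"] by auto
    then show ?thesis using generate.eng[of u "free_group X" "set B" v] uv(2) Suc by auto
  qed
  then show ?case using Suc by auto
qed

lemma word_value_in_products:
  assumes "set B \<subseteq> carrier (free_group X)" "fst ` set w \<subseteq> set B" "length w \<le> N"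
  shows "word_value (free_group X) w \<in> set (products B N)"
  using assms(2,3)
proof (induction w arbitrary: N)
  case Nil
  interpret group "free_group X" by (rule group_free_group)
  show ?case using products_mono[of B 0 N] by simp
next
  case (Cons a w)
  interpret group "free_group X" by (rule group_free_group)
  obtain M where N: "N = Suc M" using Cons.prems by (cases N) auto
  have "letter_value (free_group X) a = (if snd a then fst a else word_inv (fst a))"
    using Cons.prems assms(1) by (intro letter_value_free_group) auto
  then have "letter_value (free_group X) a \<in> set (signed B)"
    using Cons.prems by (auto simp: signed_def)
  moreover have "word_value (free_group X) w \<in> set (products B M)"
    using Cons N by auto
  ultimately show ?case by (auto simp: N)
qed

lemma generate_imp_products:
  assumes "set B \<subseteq> carrier (free_group X)" "g \<in> generate (free_group X) (set B)"
  shows "\<exists>N. \<forall>M\<ge>N. g \<in> set (products B M)"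
proof -
  interpret group "free_group X" by (rule group_free_group)
  obtain w where "w \<in> carrier (free_group (set B))" "g = word_value (free_group X) w"
    using assms word_value_image[OF assms(1)] by blast
  then show ?thesis using word_value_in_products[OF assms(1), of w] by auto
qed

text \<open>For Nielsen reduced sets this makes membership in the generated subgroup decidable: the number of
factors is at most the length of the product.\<close>

lemma nielsen_in_products:
  assumes "nielsen_reduced (set B)" "set B \<subseteq> carrier (free_group X)"
    "g \<in> generate (free_group X) (set B)" "length g \<le> N"
  shows "g \<in> set (products B N)"
proof -
  interpret group "free_group X" by (rule group_free_group)
  obtain w where w: "w \<in> carrier (free_group (set B))" "g = word_value (free_group X) w"
    using assms word_value_image[OF assms(2)] by blast
  then have "length w \<le> N" using nielsen_word_value(1)[OF assms(1,2) w(1)] assms(4) by simp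
  then show ?thesis using word_value_in_products[OF assms(2), of w N] w by auto
qed

lemma alphabet_carrier: "set (alphabet n) \<subseteq> carrier (F n)"
  by (auto simp: alphabet_def reduced_Cons)

lemma short_words:
  assumes "w \<in> carrier (F n)" "length w \<le> N"
  shows "w \<in> set (products (alphabet n) N)"
  using assms
proof (induction w arbitrary: N)
  case Nil
  then show ?case using products_mono[of "alphabet n" 0 N] by simp
next
  case (Cons a w)
  obtain M where N: "N = Suc M" using Cons.prems by (cases N) auto
  have "fst a \<in> {1..n}" using Cons.prems by auto
  then have "[(fst a, True)] \<in> set (alphabet n)" by (auto simp: alphabet_def)
  then have x: "[(fst a, True)] \<in> with_inverses (set (alphabet n))" by (rule subset_with_inverses)
  then have "word_inv [(fst a, True)] \<in> with_inverses (set (alphabet n))"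
    by (simp only: with_inverses_word_inv)
  with x have "[a] \<in> set (signed (alphabet n))"
    unfolding set_signed by (cases a; cases "snd a") (simp_all add: inv_letter_def)
  moreover have "w \<in> set (products (alphabet n) M)"
    using Cons N by (auto simp: reduced_Cons)
  moreover have "a # w = [a] \<star> w"
    using Cons.prems by (simp add: word_mult_def)
  ultimately show ?case unfolding N by auto
qed

lemma length_le_concat: "h \<in> set hs \<Longrightarrow> length h \<le> length (concat hs)"
  by (induction hs) auto

lemma candidatesD:
  assumes hs: "set hs \<subseteq> carrier (F n)" and B: "B \<in> set (candidates n hs)"
  shows "distinct B" "set B \<subseteq> carrier (F n)" "nielsen_reduced (set B)"
    "set hs \<subseteq> generate (F n) (set B)"
proof -
  interpret group "F n" by (rule group_free_group)
  have B': "B \<in> set (subseqs (remdups (products (alphabet n) (length (concat hs)))))"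
    "nielsen_reduced (set B)" "\<forall>h\<in>set hs. h \<in> set (products B (length (concat hs)))"
    using B by (auto simp: candidates_def Let_def)
  show "distinct B" using B'(1) by (rule subseqs_distinctD) simp
  have "set B \<in> Pow (set (products (alphabet n) (length (concat hs))))"
    using B'(1) subseqs_powset[of "remdups (products (alphabet n) (length (concat hs)))"] by auto
  then show sub: "set B \<subseteq> carrier (F n)"
    using products_subset_generate[OF alphabet_carrier] generate_in_carrier[OF alphabet_carrier]
    by blast
  show "nielsen_reduced (set B)" by fact
  show "set hs \<subseteq> generate (F n) (set B)" using B'(3) products_subset_generate[OF sub] by blast
qed

text \<open>Removing an element from a Nielsen reduced basis of \<open>K\<close> leaves a subgroup of \<open>K\<close> of smaller rank, which
by minimality does not contain all of \<open>hs\<close>. So each basis element is at most as long as some element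
of \<open>hs\<close>. The lemma is applied both to an overgroup of least rank and to the generated subgroup itself.\<close>

lemma candidates_complete:
  assumes hs: "set hs \<subseteq> carrier (F n)"
    and K: "K \<in> fg_overgroups (F n) (generate (F n) (set hs))"
    and minimal: "\<And>K'. K' \<in> fg_overgroups (F n) (generate (F n) (set hs)) \<Longrightarrow> K' \<subseteq> K \<Longrightarrow>
      group_rank (F n\<lparr>carrier := K\<rparr>) \<le> group_rank (F n\<lparr>carrier := K'\<rparr>)"
  obtains B where "B \<in> set (candidates n hs)" "generate (F n) (set B) = K"
proof -
  interpret group "F n" by (rule group_free_group)
  have "finite {1..n}" by simp
  then obtain B where B: "finite B" "B \<subseteq> carrier (F n)" "generate (F n) B = K"
    "card B = group_rank (F n\<lparr>carrier := K\<rparr>)" "nielsen_reduced B"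
    using nielsen_generators_exist[of "{1..n}" K] K by (simp add: fg_overgroups_def) blast
  have hsK: "set hs \<subseteq> K" using K by (auto simp: fg_overgroups_def intro: generate.incl)
  have short: "length b \<le> length (concat hs)" if b: "b \<in> B" for b
  proof -
    have "\<not> set hs \<subseteq> generate (F n) (B - {b})"
    proof
      assume "set hs \<subseteq> generate (F n) (B - {b})"
      moreover have sub: "B - {b} \<subseteq> carrier (F n)" using B(2) by blast
      ultimately have "generate (F n) (set hs) \<subseteq> generate (F n) (B - {b})"
        by (intro generate_subgroup_incl generate_is_subgroup)
      then have "generate (F n) (B - {b}) \<in> fg_overgroups (F n) (generate (F n) (set hs))"
        using B(1) sub by (intro generate_in_fg_overgroups) auto
      moreover have "generate (F n) (B - {b}) \<subseteq> K"
        unfolding B(3)[symmetric] by (rule mono_generate) blast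
      ultimately have "card B \<le> card (B - {b})"
        using minimal subgroup_rank_le[OF _ sub] B(1,4) by fastforce
      then show False using b B(1) card_gt_0_iff[of B] by (auto simp: card_Diff_singleton)
    qed
    then obtain s where "s \<in> set hs" "length b \<le> length s"
      using nielsen_irredundant_length[OF B(5,2)] hsK B(3) by blast
    then show ?thesis using length_le_concat[of s hs] by simp
  qed
  then have "B \<subseteq> set (remdups (products (alphabet n) (length (concat hs))))"
    using B(2) short_words[of _ n "length (concat hs)"] by auto
  then obtain Bl where Bl: "Bl \<in> set (subseqs (remdups (products (alphabet n) (length (concat hs)))))"
    "set Bl = B"
    using subset_subseqs by (metis imageE)
  moreover have "h \<in> set (products Bl (length (concat hs)))" if "h \<in> set hs" for h
    using that B Bl hsK length_le_concat by (intro nielsen_in_products[where X = "{1..n}"]) auto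
  ultimately have "Bl \<in> set (candidates n hs)" using B(5) by (simp add: candidates_def Let_def)
  then show ?thesis using that B(3) Bl(2) by blast
qed

lemma candidate_overgroup:
  assumes "set hs \<subseteq> carrier (F n)" "B \<in> set (candidates n hs)"
  shows "generate (F n) (set B) \<in> fg_overgroups (F n) (generate (F n) (set hs))"
    "group_rank (F n\<lparr>carrier := generate (F n) (set B)\<rparr>) = length B"
proof -
  interpret group "F n" by (rule group_free_group)
  note B = candidatesD[OF assms]
  have "generate (F n) (set hs) \<subseteq> generate (F n) (set B)"
    using B by (intro generate_subgroup_incl generate_is_subgroup)
  then show "generate (F n) (set B) \<in> fg_overgroups (F n) (generate (F n) (set hs))"
    using B(2) by (intro generate_in_fg_overgroups) auto
  show "group_rank (F n\<lparr>carrier := generate (F n) (set B)\<rparr>) = length B"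
    using nielsen_rank[OF B(3,2)] distinct_card[OF B(1)] by simp
qed

definition optimal_basis :: "nat \<Rightarrow> nat word list \<Rightarrow> nat word list" where
  "optimal_basis n hs = shortest (candidates n hs)"

lemma optimal_basis:
  assumes hs: "set hs \<subseteq> carrier (F n)"
  shows "optimal_basis n hs \<in> set (candidates n hs)"
    and "K \<in> fg_overgroups (F n) (generate (F n) (set hs)) \<Longrightarrow>
      length (optimal_basis n hs) \<le> group_rank (F n\<lparr>carrier := K\<rparr>)"
proof -
  interpret group "F n" by (rule group_free_group)
  let ?O = "fg_overgroups (F n) (generate (F n) (set hs))"
  let ?rank = "\<lambda>K. group_rank (F n\<lparr>carrier := K\<rparr>)"
  have "generate (F n) (set hs) \<in> ?O" using hs by (intro generate_in_fg_overgroups) auto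
  then obtain K0 where K0: "K0 \<in> ?O" "\<And>K. K \<in> ?O \<Longrightarrow> ?rank K0 \<le> ?rank K"
    using ex_has_least_nat[of "\<lambda>K. K \<in> ?O" _ ?rank] by blast
  obtain B where B: "B \<in> set (candidates n hs)" "generate (F n) (set B) = K0"
    using candidates_complete[OF hs K0(1)] K0(2) by blast
  then show "optimal_basis n hs \<in> set (candidates n hs)"
    unfolding optimal_basis_def by (intro shortest_in) auto
  have "length (optimal_basis n hs) \<le> ?rank K0"
    using candidate_overgroup(2)[OF hs B(1)] B length_shortest unfolding optimal_basis_def by metis
  then show "K \<in> ?O \<Longrightarrow> length (optimal_basis n hs) \<le> ?rank K" using K0(2) by fastforce
qed

text \<open>Some candidate generates the same subgroup as \<open>hs\<close>, so its elements are products of elements of \<open>hs\<close>;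
only the number of factors is not known in advance.\<close>

lemma search_succeeds:
  assumes hs: "set hs \<subseteq> carrier (F n)"
  shows "\<exists>N. \<exists>B\<in>set (candidates n hs). spans_within hs N B"
proof -
  interpret group "F n" by (rule group_free_group)
  let ?H = "generate (F n) (set hs)"
  have "?H \<in> fg_overgroups (F n) ?H" using hs by (intro generate_in_fg_overgroups) auto
  then obtain B where B: "B \<in> set (candidates n hs)" "generate (F n) (set B) = ?H"
    by (rule candidates_complete[OF hs]) (auto simp: fg_overgroups_def)
  have "\<exists>N. \<forall>M\<ge>N. b \<in> set (products hs M)" if "b \<in> set B" for b
    using that B(2) generate_imp_products[OF hs] by (metis generate.incl)
  then obtain N where N: "\<And>b M. b \<in> set B \<Longrightarrow> N b \<le> M \<Longrightarrow> b \<in> set (products hs M)" by metis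
  have "spans_within hs (\<Sum>b\<in>set B. N b) B"
    unfolding spans_within_def by (intro ballI N member_le_sum) auto
  then show ?thesis using B(1) by blast
qed

lemma rank_by_search:
  assumes hs: "set hs \<subseteq> carrier (F n)"
    and ex: "\<exists>B\<in>set (candidates n hs). spans_within hs N B"
  shows "group_rank (F n\<lparr>carrier := generate (F n) (set hs)\<rparr>)
    = length (shortest (filter (spans_within hs N) (candidates n hs)))"
proof -
  interpret group "F n" by (rule group_free_group)
  let ?B = "shortest (filter (spans_within hs N) (candidates n hs))"
  have "?B \<in> set (filter (spans_within hs N) (candidates n hs))"
    using ex by (intro shortest_in) (auto simp: filter_empty_conv)
  then have B: "?B \<in> set (candidates n hs)" "spans_within hs N ?B" by auto
  have "generate (F n) (set ?B) \<subseteq> generate (F n) (set hs)"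
    using B(2) products_subset_generate[OF hs] unfolding spans_within_def
    by (intro generate_subgroup_incl generate_is_subgroup hs) blast
  moreover have "generate (F n) (set hs) \<subseteq> generate (F n) (set ?B)"
    using candidate_overgroup(1)[OF hs B(1)] by (simp add: fg_overgroups_def)
  ultimately show ?thesis using candidate_overgroup(2)[OF hs B(1)] by simp
qed

section \<open>Computability of the algorithm\<close>

lemma computable_inv_letter [computable_intros]:
  "computable f \<Longrightarrow> computable (\<lambda>x. inv_letter (f x))"
  unfolding inv_letter_def by (intro computable_intros)

lemma computable_word_inv [computable_intros]:
  assumes "computable f"
  shows "computable (\<lambda>x. word_inv (f x))"
  unfolding word_inv_def by (intro computable_intros assms)

lemma computable_cons_cancel [computable_intros]:
  assumes "computable f" "computable g"
  shows "computable (\<lambda>x. cons_cancel (f x) (g x))"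
proof -
  have "cons_cancel a w = (case w of [] \<Rightarrow> [a] | b # v \<Rightarrow> if b = inv_letter a then v else a # b # v)"
    for a :: "'b letter" and w by (cases w) auto
  then show ?thesis
    by (simp only:) (intro computable_intros computable_compose[OF assms(1)] assms)
qed

lemma computable_word_mult [computable_intros]:
  "computable f \<Longrightarrow> computable g \<Longrightarrow> computable (\<lambda>x. f x \<star> g x)"
  unfolding word_mult_def reduce_def by (intro computable_intros)

lemma computable_signed [computable_intros]:
  "computable f \<Longrightarrow> computable (\<lambda>x. signed (f x))"
  unfolding signed_def by (intro computable_intros)

lemma computable_products [computable_intros]:
  assumes "computable f" "computable N"
  shows "computable (\<lambda>x. products (f x) (N x))"
proof -
  have "products B N = rec_nat [[]] (\<lambda>_ P. P @ concat (map (\<lambda>u. map (word_mult u) P) (signed B))) N"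
    for B :: "'b word list" and N by (induction N) simp_all
  then show ?thesis
    by (simp only:) (intro computable_intros computable_compose[OF assms(1)] assms(2))
qed

lemma nielsen_reduced_list:
  "nielsen_reduced (set B) \<longleftrightarrow> (\<forall>b\<in>set B. word_inv b \<notin> set B) \<and>
     (\<forall>x\<in>set (signed B). \<forall>y\<in>set (signed B). y \<noteq> word_inv x \<longrightarrow>
        length x \<le> length (x \<star> y) \<and>
        (\<forall>z\<in>set (signed B). z \<noteq> word_inv y \<longrightarrow>
           length x + length z < length (x \<star> y) + length (y \<star> z)))"
  unfolding nielsen_reduced_def set_signed by blast

lemma computable_nielsen_reduced [computable_intros]:
  assumes "computable f"
  shows "computable (\<lambda>x. nielsen_reduced (set (f x)))"
proof -
  have "computable (\<lambda>B :: 'b word list. nielsen_reduced (set B))"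
    unfolding nielsen_reduced_list by (intro computable_intros)
  then show ?thesis by (rule computable_compose[OF _ assms])
qed

lemma computable_candidates [computable_intros]:
  assumes "computable f"
  shows "computable (\<lambda>x. candidates n (f x))"
proof -
  have "computable (candidates n)"
    unfolding candidates_def Let_def by (intro computable_intros)
  then show ?thesis by (rule computable_compose[OF _ assms])
qed

lemma computable_shortest [computable_intros]:
  "computable f \<Longrightarrow> computable (\<lambda>x. shortest (f x))"
  unfolding shortest_def by (intro computable_intros)

lemma computable_spans_within [computable_intros]:
  assumes "computable f" "computable N" "computable g"
  shows "computable (\<lambda>x. spans_within (f x) (N x) (g x))"
  unfolding spans_within_def
  by (intro computable_intros computable_compose[OF assms(1)] computable_compose[OF assms(2)] assms(3))

text \<open>The least denominator of a fraction is the one in lowest terms.\<close>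

definition lowest_terms :: "nat \<Rightarrow> nat \<Rightarrow> nat \<times> nat" where
  "lowest_terms a b =
    (let q = least_below (Suc b) (\<lambda>q. 0 < q \<and> (\<exists>p\<in>set [0..<Suc a]. p * b = a * q))
     in (least_below (Suc a) (\<lambda>p. p * b = a * q), q))"

lemma computable_lowest_terms [computable_intros]:
  assumes "computable f" "computable g"
  shows "computable (\<lambda>x. lowest_terms (f x) (g x))"
proof (rule computable_compose2[of lowest_terms, OF _ assms])
  show "computable (\<lambda>p. lowest_terms (fst p) (snd p))"
    unfolding lowest_terms_def Let_def by (intro computable_intros)
qed

lemma quotient_of_nat_div:
  assumes "0 < b"
  shows "quotient_of (of_nat a / of_nat b) = map_prod int int (lowest_terms a b)"
proof -
  obtain p' q' where pq: "quotient_of (of_nat a / of_nat b) = (p', q')" by fastforce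
  have "q' > 0" using quotient_of_denom_pos[OF pq] .
  then obtain q where q: "q' = int q" "q > 0" using pos_int_cases by blast
  have r: "(of_nat a / of_nat b :: rat) = of_int p' / of_int q'" using quotient_of_div[OF pq] .
  then have cross: "of_nat a * of_int q' = (of_int p' * of_nat b :: rat)"
    using assms \<open>q' > 0\<close> by (simp add: field_simps)
  then have cross': "int a * q' = p' * int b"
    by (metis of_int_eq_iff of_int_mult of_int_of_nat_eq)
  have "0 \<le> p' * int b" unfolding cross'[symmetric] using \<open>q' > 0\<close> by simp
  then have "0 \<le> p'" using assms by (simp add: zero_le_mult_iff)
  then obtain p where p: "p' = int p" using nonneg_int_cases by blast
  have eq: "p * b = a * q" using cross' p q by (metis of_nat_eq_iff of_nat_mult)
  have "coprime p q" using quotient_of_coprime[OF pq] p q by simp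
  have "q dvd b" using eq \<open>coprime p q\<close>
    by (metis coprime_commute coprime_dvd_mult_right_iff dvd_triv_right)
  then have "q \<le> b" using assms by (rule dvd_imp_le)
  then have "p * b \<le> a * b" unfolding eq by simp
  then have "p \<le> a" using assms by simp
  have "least_below (Suc b) (\<lambda>q. 0 < q \<and> (\<exists>p\<in>set [0..<Suc a]. p * b = a * q)) = q"
  proof (rule least_below_eqI)
    fix j assume "0 < j \<and> (\<exists>p\<in>set [0..<Suc a]. p * b = a * j)"
    then obtain i where i: "0 < j" "i * b = a * j" by blast
    have "(i * q) * b = (p * j) * b" using i(2) eq by (metis mult.assoc mult.commute)
    then have "i * q = p * j" using assms by simp
    then have "q dvd j" using \<open>coprime p q\<close>
      by (metis coprime_commute coprime_dvd_mult_right_iff dvd_triv_right)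
    then show "q \<le> j" using i(1) by (rule dvd_imp_le)
  next
    have "p \<in> set [0..<Suc a]" using \<open>p \<le> a\<close> by (simp del: upt_Suc)
    then show "0 < q \<and> (\<exists>p\<in>set [0..<Suc a]. p * b = a * q)" using q(2) eq by blast
  qed (use \<open>q \<le> b\<close> in simp)
  moreover have "least_below (Suc a) (\<lambda>p. p * b = a * q) = p"
    using \<open>p \<le> a\<close> eq assms by (intro least_below_eqI) (auto simp flip: eq)
  ultimately show ?thesis using pq p q by (simp add: lowest_terms_def)
qed

text \<open>The second component of the argument bounds the number of factors in products of the generators.
The code of a nonnegative integer is twice its value, hence the doubled numerator and denominator.\<close>

definition solution :: "nat \<Rightarrow> nat word list \<times> nat \<Rightarrow> (nat \<times> nat) \<times> nat word list" where
  "solution n p =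
    (let k = length (optimal_basis n (fst p)) - 1;
         h = length (shortest (filter (spans_within (fst p) (snd p)) (candidates n (fst p)))) - 1;
         r = (if k = 0 then (1, 1) else lowest_terms h k)
     in ((2 * fst r, 2 * snd r), optimal_basis n (fst p)))"

lemma computable_solution: "computable (solution n)"
  unfolding solution_def optimal_basis_def Let_def by (intro computable_intros)

lemma code_conversions: "tuple_code = encode" "word_code = encode" "letter_code = encode"
proof -
  show l: "letter_code = encode"
    by (rule ext) (auto simp: letter_code_def encode_prod_def)
  show w: "word_code = encode"
    by (rule ext) (simp add: word_code_def encode_list_def l)
  show "tuple_code = encode"
    by (rule ext) (simp add: tuple_code_def encode_list_def w)
qed

lemma int_encode_of_nat: "int_encode (int m) = 2 * m"
  by (simp add: int_encode_def sum_encode_def)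

theorem theorem1p8:
  fixes n :: nat
  shows "\<exists>(val :: nat word list \<Rightarrow> rat) (basis :: nat word list \<Rightarrow> nat word list).
    computable_on tuple_code output_code {hs. set hs \<subseteq> carrier (F n)} (\<lambda>hs. (val hs, basis hs)) \<and>
    (\<forall>hs. set hs \<subseteq> carrier (F n) \<longrightarrow>
      (let H = generate (F n) (set hs); K = generate (F n) (set (basis hs)) in
        dc (F n) H = ereal (of_rat (val hs)) \<and>
        distinct (basis hs) \<and>
        free_basis ((F n)\<lparr>carrier := K\<rparr>) (set (basis hs)) \<and>
        K \<in> fg_overgroups (F n) H \<and>
        compression_ratio (F n) H K = dc (F n) H))"
proof -
  interpret group "F n" by (rule group_free_group)
  define D where "D = {hs. set hs \<subseteq> carrier (F n)}"
  define h where "h hs = reduced_rank (F n\<lparr>carrier := generate (F n) (set hs)\<rparr>)" for hs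
  define basis where "basis = optimal_basis n"
  define k where "k hs = h (basis hs)" for hs
  define val :: "nat word list \<Rightarrow> rat"
    where "val hs = (if k hs = 0 then 1 else of_nat (h hs) / of_nat (k hs))" for hs
  define P where "P hs N \<longleftrightarrow> (\<exists>B\<in>set (candidates n hs). spans_within hs N B)" for hs N
  have k: "k hs = length (basis hs) - 1" if "hs \<in> D" for hs
    using candidate_overgroup(2)[of hs n "basis hs"] optimal_basis(1)[of hs n] that
    by (simp add: k_def h_def basis_def D_def reduced_rank_def)
  have code: "encode (solution n (hs, LEAST N. P hs N)) = output_code (val hs, basis hs)"
    if hs: "hs \<in> D" for hs
  proof -
    have "\<exists>N. P hs N" using search_succeeds[of hs n] hs by (simp add: P_def D_def)
    then have "P hs (LEAST N. P hs N)" by (rule LeastI_ex)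
    then have "h hs = length (shortest (filter (spans_within hs (LEAST N. P hs N)) (candidates n hs))) - 1"
      using rank_by_search[of hs n] hs by (simp add: h_def reduced_rank_def P_def D_def)
    moreover have "rat_code (val hs) = (let r = (if k hs = 0 then (1, 1) else lowest_terms (h hs) (k hs))
        in prod_encode (2 * fst r, 2 * snd r))"
    proof (cases "k hs = 0")
      case True
      then show ?thesis
        using int_encode_of_nat[of 1] by (simp add: rat_code_def val_def Let_def)
    next
      case False
      obtain p q where "lowest_terms (h hs) (k hs) = (p, q)" by fastforce
      then show ?thesis
        using False quotient_of_nat_div[of "k hs" "h hs"]
        by (simp add: rat_code_def val_def Let_def int_encode_of_nat)
    qed
    ultimately show ?thesis
      using k[OF hs] by (simp add: output_code_def solution_def basis_def code_conversions Let_def)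
  qed
  have "computable_on encode encode D (\<lambda>hs. solution n (hs, LEAST N. P hs N))"
  proof (rule computable_on_Least)
    show "computable (\<lambda>p. P (fst p) (snd p))"
      unfolding P_def by (intro computable_intros)
    show "\<exists>N. P hs N" if "hs \<in> D" for hs
      using search_succeeds[of hs n] that by (simp add: P_def D_def)
  qed (rule computable_solution)
  then have comp: "computable_on tuple_code output_code D (\<lambda>hs. (val hs, basis hs))"
    using code by (simp add: computable_on_def code_conversions)
  have "let H = generate (F n) (set hs); K = generate (F n) (set (basis hs)) in
      dc (F n) H = ereal (of_rat (val hs)) \<and> distinct (basis hs) \<and>
      free_basis ((F n)\<lparr>carrier := K\<rparr>) (set (basis hs)) \<and>
      K \<in> fg_overgroups (F n) H \<and> compression_ratio (F n) H K = dc (F n) H"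
    if hs: "set hs \<subseteq> carrier (F n)" for hs
  proof -
    let ?H = "generate (F n) (set hs)" and ?K = "generate (F n) (set (basis hs))"
    have cand: "basis hs \<in> set (candidates n hs)"
      unfolding basis_def using hs by (rule optimal_basis(1))
    note B = candidatesD[OF hs cand] and K = candidate_overgroup[OF hs cand]
    have "?H \<in> fg_overgroups (F n) ?H" using hs by (intro generate_in_fg_overgroups) auto
    then have H: "subgroup ?H (F n)" "finitely_generated (F n\<lparr>carrier := ?H\<rparr>)"
      by (simp_all add: fg_overgroups_def)
    have "group_rank (F n\<lparr>carrier := ?K\<rparr>) \<le> group_rank (F n\<lparr>carrier := K'\<rparr>)"
      if "K' \<in> fg_overgroups (F n) ?H" for K'
      unfolding K(2) using optimal_basis(2)[OF hs that] by (simp add: basis_def)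
    note dc = dc_eq_ratio_of_minimal_rank[OF _ H K(1) this]
    have "dc (F n) ?H = ereal (if k hs = 0 then 1 else real (h hs) / real (k hs))"
      using dc by (simp add: h_def k_def)
    also have "\<dots> = ereal (of_rat (val hs))"
      by (simp add: val_def of_rat_divide)
    finally show ?thesis
      unfolding Let_def using dc(1) B(1) K(1) nielsen_free_basis[OF B(3,2)] by auto
  qed
  then show ?thesis using comp unfolding D_def by blast
qed

end
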